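(* Let $t\ge0$ be an integer, and let $F\in\mathbb{Q}[x,y]$ be $\sigma$-invariant and such that $\omega_{F,t}=\frac{F\,dx\,dy}{(1-x^2-y^2)^{t+1}}$ is integrable. Then the integral of $\omega_{F,t}$ over $\Delta$ converges to a $\mathbb{Q}$-linear combination of $1$ and $\mathbf{G}$.
   Context: $\mathbf{G}=1-\frac1{3^2}+\frac1{5^2}-\frac1{7^2}+\cdots$ is the Catalan constant. $\Delta=\{(x,y)\in\mathbb{R}^2:x,y,1-x-y\ge0\}$. $\sigma$ is the $\mathbb{Q}$-algebra automorphism of $\mathbb{Q}[x,y]$ with $(x,y)\mapsto(-y,x)$; $\sigma$-invariant means $\sigma F=F$. Let $\widetilde X$ be the blow-up of $X=\mathbb{A}^2_{\mathbb{Q}}$ at $P=(1,0)$ and $Q=(0,1)$, with exceptional divisors $E_P$, $E_Q$ above $P$, $Q$. For nonzero $F\in\mathbb{Q}[x,y]$, viewed as a regular function on $\widetilde X$, $\mathrm{ord}_{E_P}(F)$ and $\mathrm{ord}_{E_Q}(F)$ are the coefficients of $E_P$, $E_Q$ in the Weil divisor of $F$. (Equivalently, $\mathrm{ord}_{E_P}(F)$ is the largest $s$ with $(x-1)^s\mid F(x,u(x-1))$ in $\mathbb{Q}[x,u]$, and $\mathrm{ord}_{E_Q}(F)$ is the largest $s$ with $(y-1)^s\mid F(u(y-1),y)$ in $\mathbb{Q}[u,y]$.) The form $\omega_{F,t}$ is called integrable if $\mathrm{ord}_{E_P}(F)\ge t$ and $\mathrm{ord}_{E_Q}(F)\ge t$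 (the zero form is integrable); this depends only on the differential form. *)

theory Defs
  imports "HOL-Analysis.Analysis" "HOL-Computational_Algebra.Field_as_Ring"
    "HOL-Computational_Algebra.Polynomial_Factorial"
begin

definition catalan_const :: real where
  "catalan_const = (\<Sum>k. (-1) ^ k / (2 * real k + 1)\<^sup>2)"

definition unit_triangle :: "(real \<times> real) set" where
  "unit_triangle = {(x, y). 0 \<le> x \<and> 0 \<le> y \<and> 0 \<le> 1 - x - y}"

text \<open>
  The ring \<open>\<rat>[x,y]\<close> is represented by \<^typ>\<open>rat poly poly\<close>: the outer variable is \<open>y\<close>, and
  the coefficients are polynomials in \<open>x\<close>.
\<close>

abbreviation X :: "rat poly poly" where "X \<equiv> [:[:0, 1:]:]"

abbreviation Y :: "rat poly poly" where "Y \<equiv> [:0, 1:]"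

text \<open>
  \<open>eval2 h F a b\<close> is \<open>F(a,b)\<close>, where \<open>h\<close> embeds the coefficients of \<open>F\<close> in the ring that
  contains \<open>a\<close> and \<open>b\<close>.
\<close>

definition eval2 ::
    "('a::zero \<Rightarrow> 'b::comm_semiring_1) \<Rightarrow> 'a poly poly \<Rightarrow> 'b \<Rightarrow> 'b \<Rightarrow> 'b" where
  "eval2 h F a b = poly (map_poly (\<lambda>p. poly (map_poly h p) a) F) b"

abbreviation subst2 ::
    "rat poly poly \<Rightarrow> rat poly poly \<Rightarrow> rat poly poly \<Rightarrow> rat poly poly" where
  "subst2 F a b \<equiv> eval2 (\<lambda>c. [:[:c:]:]) F a b"

definition sigma_aut :: "rat poly poly \<Rightarrow> rat poly poly" where
  "sigma_aut F = subst2 F (- Y) X"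

text \<open>
  The blow-up of the plane at \<open>P = (1,0)\<close> has an affine chart with coordinates \<open>(x,u)\<close> that maps
  to the plane by \<open>(x,u) \<mapsto> (x, u(x - 1))\<close>; it meets the exceptional divisor in the prime divisor
  \<open>x - 1 = 0\<close>. So the coefficient of this divisor in the Weil divisor of a nonzero \<open>F\<close> is the
  multiplicity of \<open>x - 1\<close> in the pullback of \<open>F\<close>. Likewise at \<open>Q = (0,1)\<close>, with chart
  \<open>(u,y) \<mapsto> (u(y - 1), y)\<close> and local equation \<open>y - 1 = 0\<close>. The chart coordinate \<open>u\<close> is
  represented by the variable that it replaces.
\<close>

definition ord_EP :: "rat poly poly \<Rightarrow> nat" where
  "ord_EP F = multiplicity (X - 1) (subst2 F X (Y * (X - 1)))"

definition ord_EQ :: "rat poly poly \<Rightarrow> nat" where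
  "ord_EQ F = multiplicity (Y - 1) (subst2 F (X * (Y - 1)) Y)"

text \<open>
  The zero polynomial is a separate case, because \<^const>\<open>multiplicity\<close> yields \<open>0\<close> for it.
\<close>

definition integrable_form :: "rat poly poly \<Rightarrow> nat \<Rightarrow> bool" where
  "integrable_form F t \<longleftrightarrow> F = 0 \<or> (t \<le> ord_EP F \<and> t \<le> ord_EQ F)"

text \<open>
  The density of \<open>F dx dy / (1 - x\<^sup>2 - y\<^sup>2)\<^sup>t\<^sup>+\<^sup>1\<close>. On \<^const>\<open>unit_triangle\<close> the denominator vanishes
  only at \<open>(1,0)\<close> and \<open>(0,1)\<close>, which form a null set.
\<close>

definition omega :: "rat poly poly \<Rightarrow> nat \<Rightarrow> real \<times> real \<Rightarrow> real" where
  "omega F t = (\<lambda>(x, y). eval2 of_rat F x y / (1 - x\<^sup>2 - y\<^sup>2) ^ (t + 1))"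

end

theory Submission
  imports Defs "HOL-Real_Asymp.Real_Asymp"
begin

text \<open>
  Write \<open>D = 1 - x\<^sup>2 - y\<^sup>2\<close>. The rotation \<open>(x,y) \<mapsto> (-y,x)\<close> has order four, and averaging over the
  group it generates shows that an invariant polynomial is a rational combination of the products
  \<open>D\<^sup>i (xy)\<^sup>k\<close> for even \<open>k\<close> and \<open>D\<^sup>i (xy)\<^sup>k (x\<^sup>2 - y\<^sup>2)\<close> for odd \<open>k\<close>
  (\<open>rotation_invariant_in_span\<close>). These products are adapted to the order at \<open>P = (1,0)\<close>: each has
  order exactly \<open>i + k\<close> there, and the leading terms of products of equal order are linearly
  independent, so no cancellation raises the order of a combination. Hence the integrability
  condition forces \<open>i + k \<ge> t\<close> in every term that occurs (\<open>sigma_invariant_expansion\<close>), and it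
  suffices to integrate each product over \<open>D\<^sup>t\<^sup>+\<^sup>1\<close> separately.

  The triangle is symmetric under exchanging \<open>x\<close> and \<open>y\<close>, and the terms with odd \<open>k\<close> change sign, so
  they contribute \<open>0\<close>. For the others put \<open>x = lu\<close>, \<open>y = l(1 - u)\<close>, \<open>w = 2u(1 - u)\<close> and then
  \<open>a = 2xy / D\<close> in place of \<open>l\<close>. With \<open>n = i + k - t \<ge> 0\<close> the integral becomes, up to a power of two,
  \<open>\<integral>\<integral> a\<^sup>k w\<^sup>n / (w + (1 - w) a)\<^sup>n\<^sup>+\<^sup>1 da du\<close> over the unit square (\<open>radial_integral\<close>,
  \<open>monomial_nn_integral\<close>). Two integrations by parts reduce it. In \<open>a\<close>, one lowers \<open>n\<close> to \<open>0\<close> at the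
  cost of rational numbers (\<open>kernel_moment_has_integral\<close>). In \<open>u\<close>, one lowers \<open>k\<close> by two, again at
  the cost of a rational number (\<open>moment_integral_step\<close>). As \<open>k\<close> is even, what remains is the case
  \<open>n = k = 0\<close>, where the double integral is \<open>\<integral> - ln w / (1 - w) du\<close>, which is twice the Catalan
  constant (\<open>catalan_integral\<close>).
\<close>

section \<open>Evaluation of bivariate polynomials at real points\<close>


lemma eval2_0 [simp]: "eval2 h 0 a b = 0"
  by (simp add: eval2_def)

lemma poly_map_poly_pCons:
  "h 0 = 0 \<Longrightarrow> poly (map_poly h (pCons c p)) a = h c + a * poly (map_poly h p) a"
  by (cases "c = 0 \<and> p = 0") (auto simp: map_poly_pCons)

lemma eval2_pCons:
  "eval2 h (pCons p F) a b = poly (map_poly h p) a + b * eval2 h F a b"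
  unfolding eval2_def by (rule poly_map_poly_pCons) simp

text \<open>
  Invariance and the order at \<open>P\<close> are identities between formal polynomials. They are used as
  identities between real functions, which requires evaluation to respect the ring operations.
\<close>

locale coefficient_hom =
  fixes h :: "'a::comm_ring_1 \<Rightarrow> 'b::comm_ring_1"
  assumes h_zero: "h 0 = 0" and h_one: "h 1 = 1"
    and h_add: "h (x + y) = h x + h y" and h_mult: "h (x * y) = h x * h y"
begin

lemma poly_map_add:
  "poly (map_poly h (p + q)) a = poly (map_poly h p) a + poly (map_poly h q) a"
proof (induction p arbitrary: q)
  case 0
  then show ?case by simp
next
  case (pCons c p)
  then show ?case
    by (cases q) (simp add: poly_map_poly_pCons h_zero h_add algebra_simps)
qed

lemma poly_map_smult:
  "poly (map_poly h (smult c q)) a = h c * poly (map_poly h q) a"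
  by (induction q) (simp_all add: poly_map_poly_pCons h_zero h_mult algebra_simps)

lemma poly_map_mult:
  "poly (map_poly h (p * q)) a = poly (map_poly h p) a * poly (map_poly h q) a"
  by (induction p)
    (simp_all add: poly_map_poly_pCons h_zero poly_map_add poly_map_smult algebra_simps)

lemma eval2_add: "eval2 h (F + G) a b = eval2 h F a b + eval2 h G a b"
proof (induction F arbitrary: G)
  case 0
  then show ?case by simp
next
  case (pCons p F)
  then show ?case
    by (cases G) (simp add: eval2_pCons poly_map_add algebra_simps)
qed

lemma eval2_smult: "eval2 h (smult p G) a b = poly (map_poly h p) a * eval2 h G a b"
  by (induction G) (simp_all add: eval2_pCons poly_map_mult algebra_simps)

lemma eval2_mult: "eval2 h (F * G) a b = eval2 h F a b * eval2 h G a b"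
  by (induction F) (simp_all add: eval2_pCons eval2_add eval2_smult algebra_simps)

lemma eval2_const: "eval2 h [:[:c:]:] a b = h c"
  by (simp add: eval2_pCons poly_map_poly_pCons h_zero)

lemma eval2_X: "eval2 h [:[:0, 1:]:] a b = a"
  by (simp add: eval2_pCons poly_map_poly_pCons h_zero h_one)

lemma eval2_Y: "eval2 h [:0, 1:] a b = b"
  by (simp add: eval2_pCons poly_map_poly_pCons h_zero h_one one_pCons)

lemma eval2_one: "eval2 h 1 a b = 1"
  using eval2_const[of 1] by (simp add: h_one one_pCons)

lemma eval2_minus: "eval2 h (- F) a b = - eval2 h F a b"
  using eval2_add[of "- F" F a b] by (simp add: eq_neg_iff_add_eq_0)

lemma eval2_diff: "eval2 h (F - G) a b = eval2 h F a b - eval2 h G a b"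
  using eval2_add[of F "- G" a b] by (simp add: eval2_minus)

lemma eval2_power: "eval2 h (F ^ n) a b = eval2 h F a b ^ n"
  by (induction n) (simp_all add: eval2_one eval2_mult)

end

interpretation rat_eval: coefficient_hom "of_rat :: rat \<Rightarrow> real"
  by unfold_locales (simp_all add: of_rat_add of_rat_mult)

abbreviation real_eval :: "rat poly poly \<Rightarrow> real \<Rightarrow> real \<Rightarrow> real" where
  "real_eval \<equiv> eval2 of_rat"

lemma real_eval_inner_subst:
  "real_eval (poly (map_poly (\<lambda>c. [:[:c:]:]) p) A) x y
    = poly (map_poly of_rat p) (real_eval A x y)"
  by (induction p)
    (simp_all add: poly_map_poly_pCons rat_eval.eval2_add rat_eval.eval2_mult rat_eval.eval2_const)

lemma real_eval_subst2:
  "real_eval (subst2 F A B) x y = real_eval F (real_eval A x y) (real_eval B x y)"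
  by (induction F)
    (simp_all add: eval2_pCons rat_eval.eval2_add rat_eval.eval2_mult real_eval_inner_subst)

lemma continuous_on_real_eval [continuous_intros]:
  "continuous_on S f \<Longrightarrow> continuous_on S g \<Longrightarrow> continuous_on S (\<lambda>x. real_eval F (f x) (g x))"
  by (induction F) (auto simp: eval2_pCons intro!: continuous_intros)

lemma real_eval_as_sum:
  "real_eval F x y = (\<Sum>j\<le>degree F. \<Sum>i\<le>degree (coeff F j).
      of_rat (coeff (coeff F j) i) * (x ^ i * y ^ j))"
proof -
  have "poly (map_poly of_rat p) x = (\<Sum>i\<le>degree p. of_rat (coeff p i) * x ^ i)" for p
    by (subst poly_altdef) (simp add: coeff_map_poly degree_map_poly)
  moreover have "real_eval F x y = (\<Sum>j\<le>degree F. poly (map_poly of_rat (coeff F j)) x * y ^ j)"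
  proof -
    let ?H = "map_poly (\<lambda>p. poly (map_poly of_rat p) x) F"
    have "degree ?H \<le> degree F"
      by (rule map_poly_degree_leq)
    then have "poly ?H y = (\<Sum>j\<le>degree F. coeff ?H j * y ^ j)"
      unfolding poly_altdef by (intro sum.mono_neutral_left) (auto simp: coeff_eq_0)
    then show ?thesis
      by (simp add: eval2_def coeff_map_poly)
  qed
  ultimately show ?thesis
    by (simp add: sum_distrib_right mult.assoc)
qed

section \<open>Rotation-invariant polynomials\<close>

text \<open>
  The invariants of the rotation are generated by \<open>x\<^sup>2 + y\<^sup>2\<close>, \<open>(xy)\<^sup>2\<close> and \<open>xy(x\<^sup>2 - y\<^sup>2)\<close>; the last one
  is needed only to the first power, so the parity of the exponent \<open>k\<close> tells whether it occurs.
  Using \<open>1 - x\<^sup>2 - y\<^sup>2\<close> in place of \<open>x\<^sup>2 + y\<^sup>2\<close> gives every product the order \<open>i + k\<close> at \<open>(1,0)\<close>, where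
  \<open>1 - x\<^sup>2 - y\<^sup>2\<close> and \<open>xy\<close> have order one and \<open>x\<^sup>2 - y\<^sup>2\<close> does not vanish.
\<close>

definition invariant_monomial :: "nat \<Rightarrow> nat \<Rightarrow> real \<Rightarrow> real \<Rightarrow> real" where
  "invariant_monomial i k x y
    = (1 - x\<^sup>2 - y\<^sup>2) ^ i * (x * y) ^ k * (if odd k then x\<^sup>2 - y\<^sup>2 else 1)"

inductive_set invariant_span :: "(real \<Rightarrow> real \<Rightarrow> real) set" where
  zero: "(\<lambda>x y. 0) \<in> invariant_span"
| add_monomial: "f \<in> invariant_span
    \<Longrightarrow> (\<lambda>x y. of_rat c * invariant_monomial i k x y + f x y) \<in> invariant_span"

lemma invariant_span_monomial: "invariant_monomial i k \<in> invariant_span"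
  using add_monomial[OF zero, of 1 i k] by (simp add: fun_eq_iff)

lemma invariant_span_add:
  "f \<in> invariant_span \<Longrightarrow> g \<in> invariant_span \<Longrightarrow> (\<lambda>x y. f x y + g x y) \<in> invariant_span"
proof (induction rule: invariant_span.induct)
  case (add_monomial f c i k)
  from invariant_span.add_monomial[OF add_monomial.IH[OF add_monomial.prems], of c i k]
  show ?case by (simp add: add.assoc)
qed simp

lemma invariant_span_scale:
  "f \<in> invariant_span \<Longrightarrow> (\<lambda>x y. of_rat r * f x y) \<in> invariant_span"
proof (induction rule: invariant_span.induct)
  case (add_monomial f c i k)
  from invariant_span.add_monomial[OF add_monomial.IH, of "r * c" i k]
  show ?case by (simp add: of_rat_mult algebra_simps)
qed (simp add: invariant_span.zero)

lemma invariant_span_sum: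
  "(\<And>i. i \<in> I \<Longrightarrow> f i \<in> invariant_span) \<Longrightarrow> (\<lambda>x y. \<Sum>i\<in>I. f i x y) \<in> invariant_span"
  by (induction I rule: infinite_finite_induct) (auto intro: invariant_span_add zero)

lemma invariant_span_times_conic:
  "f \<in> invariant_span \<Longrightarrow> (\<lambda>x y. (1 - x\<^sup>2 - y\<^sup>2) * f x y) \<in> invariant_span"
proof (induction rule: invariant_span.induct)
  case (add_monomial f c i k)
  have "(1 - x\<^sup>2 - y\<^sup>2) * invariant_monomial i k x y = invariant_monomial (Suc i) k x y" for x y
    by (simp add: invariant_monomial_def)
  with invariant_span.add_monomial[OF add_monomial.IH, of c "Suc i" k]
  show ?case by (simp add: distrib_left mult.left_commute)
qed (simp add: invariant_span.zero)

lemma invariant_span_times_product: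
  "f \<in> invariant_span \<Longrightarrow> (\<lambda>x y. (x * y)\<^sup>2 * f x y) \<in> invariant_span"
proof (induction rule: invariant_span.induct)
  case (add_monomial f c i k)
  have "(x * y)\<^sup>2 * invariant_monomial i k x y = invariant_monomial i (k + 2) x y" for x y
    by (simp add: invariant_monomial_def power_add power2_eq_square mult_ac)
  with invariant_span.add_monomial[OF add_monomial.IH, of c i "k + 2"]
  show ?case by (simp add: distrib_left mult.left_commute)
qed (simp add: invariant_span.zero)

text \<open>
  For \<open>p\<^sub>d = x\<^sup>2\<^sup>d \<plusminus> y\<^sup>2\<^sup>d\<close> one has \<open>p\<^sub>d\<^sub>+\<^sub>2 = (x\<^sup>2 + y\<^sup>2) p\<^sub>d\<^sub>+\<^sub>1 - (xy)\<^sup>2 p\<^sub>d\<close>, and the span is closed under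
  multiplication by both coefficients. The sign \<open>(-1)\<^sup>m\<close> is the one for which the product with
  \<open>(xy)\<^sup>m\<close> is invariant under the rotation.
\<close>

lemma invariant_span_power_sum:
  "(\<lambda>x y. (x * y) ^ m * (x ^ (2 * d) + (-1) ^ m * y ^ (2 * d))) \<in> invariant_span"
proof (induction d rule: induct_nat_012)
  case 0
  show ?case
    using invariant_span_scale[OF invariant_span_monomial[of 0 m], of 2] zero
    by (cases "even m") (simp_all add: invariant_monomial_def mult.commute)
next
  case 1
  show ?case
  proof (cases "even m")
    case True
    have "p + -1 * ((1 - x\<^sup>2 - y\<^sup>2) * p) = p * (x\<^sup>2 + y\<^sup>2)" for p x y :: real
      by (simp add: algebra_simps)
    from this[of "(x * y) ^ m" x y for x y] True have "invariant_monomial 0 m x y + of_rat (-1) * invariant_monomial 1 m x y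
        = (x * y) ^ m * (x ^ (2 * 1) + (-1) ^ m * y ^ (2 * 1))" for x y
      by (simp add: invariant_monomial_def)
    with invariant_span_add[OF invariant_span_monomial[of 0 m]
        invariant_span_scale[OF invariant_span_monomial[of 1 m], of "-1"]]
    show ?thesis by (simp only: One_nat_def)
  next
    case False
    with invariant_span_monomial[of 0 m] show ?thesis
      by (simp add: invariant_monomial_def[abs_def])
  qed
next
  case (ge2 d)
  let ?P = "\<lambda>d x y :: real. (x * y) ^ m * (x ^ (2 * d) + (-1) ^ m * y ^ (2 * d))"
  have "?P (Suc (Suc d)) x y = ?P (Suc d) x y
      + (of_rat (-1) * ((1 - x\<^sup>2 - y\<^sup>2) * ?P (Suc d) x y) + of_rat (-1) * ((x * y)\<^sup>2 * ?P d x y))"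
    for x y
    by (simp add: power2_eq_square algebra_simps)
  with invariant_span_add[OF ge2(2) invariant_span_add[OF
        invariant_span_scale[OF invariant_span_times_conic[OF ge2(2)], of "-1"]
        invariant_span_scale[OF invariant_span_times_product[OF ge2(1)], of "-1"]]]
  show ?case by (simp only:)
qed

text \<open>
  The sum over the four rotations kills a monomial of odd total degree. Otherwise both exponents
  have the same parity, and after the common power of \<open>xy\<close> is taken out, a power sum or a
  difference of powers of \<open>x\<^sup>2\<close> and \<open>y\<^sup>2\<close> is left.
\<close>

lemma invariant_span_monomial_average:
  "(\<lambda>x y. x ^ i * y ^ j + (- y) ^ i * x ^ j + (- x) ^ i * (- y) ^ j + y ^ i * (- x) ^ j)
    \<in> invariant_span" (is "?M \<in> _")
proof (cases "even (i + j)")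
  case False
  then have "?M = (\<lambda>x y. 0)"
    by (auto simp: fun_eq_iff power_minus_odd power_minus_even mult.commute)
  then show ?thesis using zero by simp
next
  case True
  then have sign: "(-1) ^ j = (-1 :: real) ^ i" by (auto simp: minus_one_power_iff)
  have M: "?M x y = 2 * (x ^ i * y ^ j + (-1) ^ i * (y ^ i * x ^ j))" for x y
  proof -
    define s :: real where "s = (-1) ^ i"
    have s: "s = 1 \<or> s = -1"
      by (simp add: s_def minus_one_power_iff)
    have minus: "(- z) ^ i = s * z ^ i" "(- z) ^ j = s * z ^ j" for z :: real
      unfolding s_def by (metis power_minus, metis power_minus sign)
    show ?thesis
      unfolding minus s_def[symmetric] using s by (auto simp: algebra_simps)
  qed
  show ?thesis
  proof (cases "j \<le> i")
    case le: True
    with True obtain d where d: "i = j + 2 * d"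
      by (metis even_add evenE le_add_diff_inverse)
    have "?M x y = of_rat 2 * ((x * y) ^ j * (x ^ (2 * d) + (-1) ^ j * y ^ (2 * d)))" for x y
      unfolding M unfolding sign[symmetric] unfolding d
      by (simp add: power_add power_mult_distrib algebra_simps)
    with invariant_span_scale[OF invariant_span_power_sum] show ?thesis by (simp only:)
  next
    case le: False
    with True obtain d where d: "j = i + 2 * d"
      by (metis even_add evenE le_add_diff_inverse nat_le_linear)
    have "?M x y = of_rat (2 * (-1) ^ i) * ((x * y) ^ i * (x ^ (2 * d) + (-1) ^ i * y ^ (2 * d)))"
      for x y
      unfolding M unfolding d
      by (cases "even i") (simp_all add: power_add power_mult_distrib algebra_simps)
    with invariant_span_scale[OF invariant_span_power_sum] show ?thesis by (simp only:)
  qed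
qed

lemma rotation_invariant_in_span:
  assumes "\<And>x y. real_eval F (- y) x = real_eval F x y"
  shows "real_eval F \<in> invariant_span"
proof -
  let ?f = "real_eval F"
  let ?M = "\<lambda>i j x y :: real.
    x ^ i * y ^ j + (- y) ^ i * x ^ j + (- x) ^ i * (- y) ^ j + y ^ i * (- x) ^ j"
  have "?f x y = of_rat (1/4) * (\<Sum>j\<le>degree F. \<Sum>i\<le>degree (coeff F j).
      of_rat (coeff (coeff F j) i) * ?M i j x y)" for x y
  proof -
    have "?f (- y) x = ?f x y" "?f (- x) (- y) = ?f x y" "?f y (- x) = ?f x y"
      using assms[of y x] assms[of x "- y"] assms[of "-y" "-x"] assms[of "-x" y] by simp_all
    then have "?f x y = of_rat (1/4) * (?f x y + ?f (- y) x + ?f (- x) (- y) + ?f y (- x))"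
      by (simp add: of_rat_divide)
    also have "?f x y + ?f (- y) x + ?f (- x) (- y) + ?f y (- x)
      = (\<Sum>j\<le>degree F. \<Sum>i\<le>degree (coeff F j). of_rat (coeff (coeff F j) i) * ?M i j x y)"
      unfolding real_eval_as_sum by (simp only: sum.distrib distrib_left)
    finally show ?thesis .
  qed
  then have "?f = (\<lambda>x y. of_rat (1/4) * (\<Sum>j\<le>degree F. \<Sum>i\<le>degree (coeff F j).
      of_rat (coeff (coeff F j) i) * ?M i j x y))"
    by (intro ext)
  then show ?thesis
    by (simp only:)
      (intro invariant_span_scale invariant_span_sum invariant_span_monomial_average)
qed

text \<open>
  The coefficients are indexed by \<open>e = i + k\<close>, the order at \<open>(1,0)\<close>, and by \<open>k\<close>.
\<close>

lemma invariant_span_coefficients: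
  assumes "f \<in> invariant_span"
  obtains N :: nat and c :: "nat \<Rightarrow> nat \<Rightarrow> rat" where
    "\<And>x y. f x y = (\<Sum>e\<le>N. \<Sum>k\<le>e. of_rat (c e k) * invariant_monomial (e - k) k x y)"
proof -
  \<comment> \<open>Allowing every larger bound \<open>M\<close> lets the induction step enlarge \<open>N\<close> without reindexing.\<close>
  have "\<exists>N c. \<forall>M\<ge>N. \<forall>x y. f x y
      = (\<Sum>e\<le>M. \<Sum>k\<le>e. of_rat (c e k) * invariant_monomial (e - k) k x y)"
    using assms
  proof induction
    case zero
    show ?case by (intro exI[of _ 0] exI[of _ "\<lambda>e k. 0"]) simp
  next
    case (add_monomial f r i k)
    then obtain N c where c: "\<And>M x y. N \<le> M \<Longrightarrow> f x y
        = (\<Sum>e\<le>M. \<Sum>l\<le>e. of_rat (c e l) * invariant_monomial (e - l) l x y)"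
      by blast
    let ?d = "\<lambda>e l. if e = i + k \<and> l = k then r else 0"
    have "of_rat r * invariant_monomial i k x y + f x y
        = (\<Sum>e\<le>M. \<Sum>l\<le>e. of_rat (?d e l + c e l) * invariant_monomial (e - l) l x y)"
      if M: "max N (i + k) \<le> M" for M x y
    proof -
      have "(\<Sum>l\<le>e. of_rat (?d e l) * invariant_monomial (e - l) l x y)
          = (if e = i + k then of_rat r * invariant_monomial i k x y else 0)" for e
        by (auto simp: if_distrib if_distribR sum.delta cong: if_cong intro!: sum.neutral)
      then have "(\<Sum>e\<le>M. \<Sum>l\<le>e. of_rat (?d e l) * invariant_monomial (e - l) l x y)
          = of_rat r * invariant_monomial i k x y"
        using M by (simp add: sum.delta)
      moreover have "f x y = (\<Sum>e\<le>M. \<Sum>l\<le>e. of_rat (c e l) * invariant_monomial (e - l) l x y)"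
        using M c by simp
      ultimately show ?thesis
        by (simp only: of_rat_add distrib_right sum.distrib)
    qed
    then show ?case
      by (intro exI[of _ "max N (i + k)"] exI[of _ "\<lambda>e l. ?d e l + c e l"]) blast
  qed
  with that show thesis by blast
qed

section \<open>The order at the point (1,0)\<close>

text \<open>
  The substitution \<open>x = 1 + s\<close>, \<open>y = us\<close> is the chart of the blow-up, with \<open>s = 0\<close> on the exceptional
  divisor. A product of order \<open>e\<close> becomes \<open>s\<^sup>e\<close> times a function with value \<open>(-2)\<^sup>e\<^sup>-\<^sup>k u\<^sup>k\<close> at \<open>s = 0\<close>.
  For fixed \<open>e\<close> these are distinct powers of \<open>u\<close>, so the coefficient of the lowest order that
  occurs cannot cancel.
\<close>

lemma order_bounds_coefficients:
  fixes c :: "nat \<Rightarrow> nat \<Rightarrow> real" and g :: "real \<Rightarrow> real \<Rightarrow> real"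
  assumes f: "\<And>x y. f x y = (\<Sum>e\<le>N. \<Sum>k\<le>e. c e k * invariant_monomial (e - k) k x y)"
    and g: "\<And>s u. f (1 + s) (u * s) = s ^ t * g s u"
    and cont: "\<And>u. continuous_on UNIV (\<lambda>s. g s u)"
    and "e < t" "e \<le> N" "k \<le> e"
  shows "c e k = 0"
  using assms(4-6)
proof (induction e arbitrary: k rule: less_induct)
  case (less e)
  \<comment> \<open>\<open>R\<close> is the cofactor of \<open>s\<^sup>e\<close> in the chart.\<close>
  define R where "R e k s u = (- (2 + s + u\<^sup>2 * s)) ^ (e - k) * ((1 + s) * u) ^ k
      * (if odd k then (1 + s)\<^sup>2 - (u * s)\<^sup>2 else 1)" for e k and s u :: real
  have R: "invariant_monomial (e - k) k (1 + s) (u * s) = s ^ e * R e k s u"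
    if "k \<le> e" for e k s u
  proof -
    have "1 - (1 + s)\<^sup>2 - (u * s)\<^sup>2 = s * (- (2 + s + u\<^sup>2 * s))"
      by (simp add: power2_eq_square algebra_simps)
    moreover have "(1 + s) * (u * s) = s * ((1 + s) * u)"
      by simp
    moreover have "s ^ e = s ^ (e - k) * s ^ k"
      using that by (simp flip: power_add)
    ultimately show ?thesis
      unfolding invariant_monomial_def R_def by (simp add: power_mult_distrib)
  qed
  have "(\<Sum>k\<le>e. (c e k * (- 2) ^ (e - k)) * u ^ k) = 0" for u
  proof -
    let ?S = "\<lambda>s. \<Sum>d\<in>{e..N}. \<Sum>k\<le>d. c d k * (s ^ (d - e) * R d k s u)"
    \<comment> \<open>Both sides are continuous in \<open>s\<close>, so they also agree in the limit \<open>s = 0\<close>.\<close>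
    have eq: "s ^ (t - e) * g s u = ?S s" if "s \<noteq> 0" for s
    proof -
      have "s ^ e * (s ^ (t - e) * g s u) = f (1 + s) (u * s)"
        using less.prems g by (simp flip: mult.assoc power_add)
      also have "\<dots> = (\<Sum>d\<le>N. \<Sum>k\<le>d. c d k * (s ^ d * R d k s u))"
        unfolding f by (intro sum.cong refl) (simp add: R)
      also have "\<dots> = (\<Sum>d\<in>{e..N}. \<Sum>k\<le>d. c d k * (s ^ d * R d k s u))"
        using less by (intro sum.mono_neutral_right) (auto intro!: sum.neutral)
      also have "\<dots> = s ^ e * ?S s"
        unfolding sum_distrib_left
      proof (intro sum.cong refl)
        fix d k assume "d \<in> {e..N}"
        then have "s ^ d = s ^ e * s ^ (d - e)"
          by (simp flip: power_add)
        then show "c d k * (s ^ d * R d k s u) = s ^ e * (c d k * (s ^ (d - e) * R d k s u))"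
          by simp
      qed
      finally show ?thesis using that by simp
    qed
    have "((\<lambda>s. s ^ (t - e) * g s u) \<longlongrightarrow> 0 ^ (t - e) * g 0 u) (at 0)"
      using cont[of u] by (intro tendsto_intros) (simp add: continuous_on_def)
    moreover have "((\<lambda>s. s ^ (t - e) * g s u) \<longlongrightarrow> ?S 0) (at 0)"
    proof (rule Lim_transform_eventually)
      have "continuous_on UNIV ?S"
      proof -
        have "continuous_on UNIV (\<lambda>s. R d k s u)" for d k
          unfolding R_def by (cases "odd k") (auto intro!: continuous_intros)
        then show ?thesis by (auto intro!: continuous_on_sum continuous_on_mult continuous_on_power continuous_on_const continuous_on_id)
      qed
      then show "(?S \<longlongrightarrow> ?S 0) (at 0)" by (simp add: continuous_on_def)
      show "\<forall>\<^sub>F s in at 0. ?S s = s ^ (t - e) * g s u"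
        using eq by (auto simp: eventually_at_filter)
    qed
    ultimately have "0 ^ (t - e) * g 0 u = ?S 0"
      by (rule LIM_unique)
    moreover have "0 ^ (t - e) = (0 :: real)"
      using less.prems by simp
    ultimately have "0 = ?S 0"
      by (simp only: mult_zero_left)
    also have "?S 0 = (\<Sum>d\<in>{e..N}. if d = e then (\<Sum>k\<le>e. c e k * R e k 0 u) else 0)"
      by (intro sum.cong refl) (auto intro!: sum.neutral)
    also have "\<dots> = (\<Sum>k\<le>e. c e k * R e k 0 u)"
      using less.prems by (simp add: sum.delta)
    also have "\<dots> = (\<Sum>k\<le>e. (c e k * (- 2) ^ (e - k)) * u ^ k)"
      unfolding R_def by (intro sum.cong refl) simp
    finally show ?thesis by (rule sym)
  qed
  then have "\<forall>u. (\<Sum>k\<le>e. (c e k * (- 2) ^ (e - k)) * u ^ k) = 0"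
    by blast
  then have "\<forall>k\<le>e. c e k * (- 2) ^ (e - k) = 0"
    by (rule polyfun_eq_0[THEN iffD1])
  with less.prems show ?case by simp
qed

lemma sigma_invariant_expansion:
  assumes "sigma_aut F = F" and "integrable_form F t"
  obtains N :: nat and c :: "nat \<Rightarrow> nat \<Rightarrow> rat" where
    "\<And>x y. real_eval F x y
       = (\<Sum>e\<in>{t..N}. \<Sum>k\<le>e. of_rat (c e k) * invariant_monomial (e - k) k x y)"
proof -
  have "real_eval F (- y) x = real_eval F x y" for x y
    using real_eval_subst2[of F "- Y" X x y] assms(1)[unfolded sigma_aut_def]
    by (simp only: rat_eval.eval2_minus rat_eval.eval2_X rat_eval.eval2_Y)
  then have span: "real_eval F \<in> invariant_span"
    by (rule rotation_invariant_in_span)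
  obtain N c where c: "\<And>x y. real_eval F x y
      = (\<Sum>e\<le>N. \<Sum>k\<le>e. of_rat (c e k) * invariant_monomial (e - k) k x y)"
    by (rule invariant_span_coefficients[OF span], rule that)
  have "(X - 1) ^ t dvd subst2 F X (Y * (X - 1))"
  proof (cases "F = 0")
    case False
    with assms(2) show ?thesis
      by (intro multiplicity_dvd') (simp add: integrable_form_def ord_EP_def)
  qed simp
  then obtain G where G: "subst2 F X (Y * (X - 1)) = (X - 1) ^ t * G"
    by (auto elim: dvdE)
  have "real_eval F (1 + s) (u * s) = s ^ t * real_eval G (1 + s) u" for s u
    using arg_cong[OF G, of "\<lambda>H. real_eval H (1 + s) u"]
    by (simp only: real_eval_subst2 rat_eval.eval2_mult rat_eval.eval2_power rat_eval.eval2_diff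
        rat_eval.eval2_one rat_eval.eval2_X rat_eval.eval2_Y) simp
  then have "of_rat (c e k) = (0 :: real)" if "e < t" "e \<le> N" "k \<le> e" for e k
    using that
    by (intro order_bounds_coefficients[where f = "real_eval F" and t = t and N = N and e = e
          and k = k and c = "\<lambda>e k. of_rat (c e k)" and g = "\<lambda>s u. real_eval G (1 + s) u"] c)
      (auto intro!: continuous_intros)
  then have "(\<Sum>e\<le>N. \<Sum>k\<le>e. of_rat (c e k) * invariant_monomial (e - k) k x y)
      = (\<Sum>e\<in>{t..N}. \<Sum>k\<le>e. of_rat (c e k) * invariant_monomial (e - k) k x y)" for x y
    by (intro sum.mono_neutral_right) (auto intro!: sum.neutral)
  with c that show thesis by simp
qed



section \<open>An integral that equals twice the Catalan constant\<close>

text \<open>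
  This is \<open>Ti\<^sub>2(x) = \<integral> arctan s / s ds\<close> from \<open>0\<close> to \<open>x\<close>, given by its power series so that the value
  at \<open>1\<close> is visibly the Catalan constant.
\<close>

definition inverse_tangent_integral :: "real \<Rightarrow> real" where
  "inverse_tangent_integral x = (\<Sum>k. (-1) ^ k * x ^ (2 * k + 1) / (2 * real k + 1)\<^sup>2)"

lemma inverse_tangent_integral_0 [simp]: "inverse_tangent_integral 0 = 0"
  by (simp add: inverse_tangent_integral_def)

lemma inverse_tangent_integral_1: "inverse_tangent_integral 1 = catalan_const"
  by (simp add: inverse_tangent_integral_def catalan_const_def)

lemma summable_inverse_odd_squares: "summable (\<lambda>k. 1 / (2 * real k + 1)\<^sup>2)"
proof (rule summable_comparison_test')
  show "summable (\<lambda>k. inverse (real (Suc k) ^ 2))"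
    using inverse_power_summable[of 2, where ?'a = real] by (subst summable_Suc_iff) simp
  show "norm (1 / (2 * real k + 1)\<^sup>2) \<le> inverse (real (Suc k) ^ 2)" for k
    by (simp add: divide_simps power_mono)
qed

lemma continuous_on_inverse_tangent_integral:
  "continuous_on {0..1} inverse_tangent_integral"
proof (rule uniform_limit_theorem)
  show "uniform_limit {0..1} (\<lambda>n x. \<Sum>k<n. (-1) ^ k * x ^ (2 * k + 1) / (2 * real k + 1)\<^sup>2)
      inverse_tangent_integral sequentially"
    unfolding inverse_tangent_integral_def
  proof (rule Weierstrass_m_test)
    fix k and x :: real assume "x \<in> {0..1}"
    then show "norm ((-1) ^ k * x ^ (2 * k + 1) / (2 * real k + 1)\<^sup>2) \<le> 1 / (2 * real k + 1)\<^sup>2"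
      by (simp add: abs_mult divide_right_mono mult_le_one power_le_one)
  qed (rule summable_inverse_odd_squares)
  show "\<forall>\<^sub>F n in sequentially. continuous_on {0..1}
      (\<lambda>x. \<Sum>k<n. (-1) ^ k * x ^ (2 * k + 1) / (2 * real k + 1)\<^sup>2)"
    by (intro always_eventually allI continuous_intros) auto
qed simp

text \<open>
  The power series of \<open>arctan x / x\<close> converges uniformly on every \<open>[0,r]\<close> with \<open>r < 1\<close>, which permits
  differentiation term by term.
\<close>

lemma inverse_tangent_integral_deriv:
  assumes "0 < x" "x < 1"
  shows "(inverse_tangent_integral has_field_derivative arctan x / x) (at x)"
proof -
  \<comment> \<open>Any radius strictly between \<open>x\<close> and \<open>1\<close> would do.\<close>
  define r where "r = (x + 1) / 2"
  have r: "0 < r" "r < 1" "x < r" using assms by (auto simp: r_def)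
  let ?f = "\<lambda>k x. (-1) ^ k * x ^ (2 * k + 1) / (2 * real k + 1)\<^sup>2"
  let ?f' = "\<lambda>k x. (-1) ^ k * x ^ (2 * k) / (2 * real k + 1)"
  have "((\<lambda>x. \<Sum>k. ?f k x) has_field_derivative (\<Sum>k. ?f' k x)) (at x)"
  proof (rule has_field_derivative_series'(2)[where ?x0.0 = 0])
    fix k y
    have "(?f k has_field_derivative
        (-1) ^ k * (real (2 * k + 1) * y ^ (2 * k + 1 - Suc 0)) / (2 * real k + 1)\<^sup>2) (at y within {0..r})"
      by (intro DERIV_cdivide DERIV_cmult DERIV_pow)
    also have "(-1) ^ k * (real (2 * k + 1) * y ^ (2 * k + 1 - Suc 0)) / (2 * real k + 1)\<^sup>2 = ?f' k y"
      by (simp add: power2_eq_square add.commute)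
    finally show "(?f k has_field_derivative ?f' k y) (at y within {0..r})" .
  next
    show "uniformly_convergent_on {0..r} (\<lambda>n x. \<Sum>k<n. ?f' k x)"
    proof (rule Weierstrass_m_test')
      fix k and y :: real assume y: "y \<in> {0..r}"
      have "y ^ (2 * k) / (2 * real k + 1) \<le> y ^ (2 * k) / 1"
        using y by (intro divide_left_mono) auto
      also have "\<dots> \<le> (r\<^sup>2) ^ k"
        using y by (simp add: power_mono flip: power_mult)
      finally show "norm (?f' k y) \<le> (r\<^sup>2) ^ k"
        using y by (simp add: abs_mult)
    next
      show "summable (\<lambda>k. (r\<^sup>2) ^ k)"
        using r by (intro summable_geometric) (simp add: power_less_one_iff abs_square_less_1)
    qed
  qed (use r assms in auto)
  moreover have "(\<Sum>k. ?f' k x) = arctan x / x"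
  proof -
    have "arctan x / x = (\<Sum>k. (-1) ^ k * (1 / real (k * 2 + 1) * x ^ (k * 2 + 1))) / x"
      using assms by (subst arctan_series) auto
    also have "\<dots> = (\<Sum>k. (-1) ^ k * (1 / real (k * 2 + 1) * x ^ (k * 2 + 1)) / x)"
      using assms by (intro suminf_divide[symmetric] summable_arctan_series) auto
    also have "\<dots> = (\<Sum>k. ?f' k x)"
      using assms by (intro suminf_cong) (simp add: mult.commute)
    finally show ?thesis ..
  qed
  moreover have "inverse_tangent_integral = (\<lambda>x. \<Sum>k. ?f k x)"
    by (rule ext) (simp add: inverse_tangent_integral_def)
  ultimately show ?thesis by simp
qed

lemma continuous_on_ln_arctan: "continuous_on {0..1} (\<lambda>x :: real. ln x * arctan x)"
  unfolding continuous_on_def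
proof
  fix x :: real assume x: "x \<in> {0..1}"
  show "((\<lambda>x. ln x * arctan x) \<longlongrightarrow> ln x * arctan x) (at x within {0..1})"
  proof (cases "x = 0")
    case True
    have "((\<lambda>x :: real. ln x * arctan x) \<longlongrightarrow> 0) (at_right 0)"
      by real_asymp
    with True show ?thesis
      by (simp add: at_within_Icc_at_right)
  next
    case False
    with x show ?thesis
      by (intro tendsto_intros) auto
  qed
qed

lemma continuous_on_times_ln: "continuous_on {0..1} (\<lambda>x :: real. x * ln x)"
  unfolding continuous_on_def
proof
  fix x :: real assume x: "x \<in> {0..1}"
  show "((\<lambda>x. x * ln x) \<longlongrightarrow> x * ln x) (at x within {0..1})"
  proof (cases "x = 0")
    case True
    have "((\<lambda>x :: real. x * ln x) \<longlongrightarrow> 0) (at_right 0)"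
      by real_asymp
    with True show ?thesis
      by (simp add: at_within_Icc_at_right)
  next
    case False
    with x show ?thesis
      by (intro tendsto_intros) auto
  qed
qed

text \<open>
  With \<open>v = u / (1 - u)\<close> the integrand is \<open>ln v / (1 + v\<^sup>2) dv\<close>, and \<open>ln v arctan v - Ti\<^sub>2(v)\<close> is an
  antiderivative that is continuous up to \<open>v = 0\<close>.
\<close>

lemma log_ratio_integral:
  "((\<lambda>u. ln (u / (1 - u)) / (u\<^sup>2 + (1 - u)\<^sup>2)) has_integral - catalan_const) {0..1/2}"
proof -
  let ?\<Phi> = "\<lambda>x. ln x * arctan x - inverse_tangent_integral x"
  have "((\<lambda>u. ln (u / (1 - u)) / (u\<^sup>2 + (1 - u)\<^sup>2)) has_integral
      ?\<Phi> ((1/2) / (1 - 1/2)) - ?\<Phi> (0 / (1 - 0))) {0..1/2}"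
  proof (rule fundamental_theorem_of_calculus_interior)
    have "continuous_on {0..1} ?\<Phi>"
      by (intro continuous_intros continuous_on_ln_arctan continuous_on_inverse_tangent_integral)
    moreover have "continuous_on {0..1/2} (\<lambda>u :: real. u / (1 - u))"
      by (auto intro!: continuous_intros)
    moreover have "(\<lambda>u :: real. u / (1 - u)) ` {0..1/2} \<subseteq> {0..1}"
      by (auto simp: field_simps)
    ultimately show "continuous_on {0..1/2} (\<lambda>u. ?\<Phi> (u / (1 - u)))"
      by (rule continuous_on_compose2)
  next
    fix u :: real assume u: "u \<in> {0<..<1/2}"
    define x where "x = u / (1 - u)"
    have x: "0 < x" "x < 1" using u by (auto simp: x_def field_simps)
    have "(?\<Phi> has_field_derivative
        1 / x * arctan x + inverse (1 + x\<^sup>2) * ln x - arctan x / x) (at x)"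
      using x by (intro DERIV_diff DERIV_mult DERIV_ln_divide DERIV_arctan
          inverse_tangent_integral_deriv)
    also have "1 / x * arctan x + inverse (1 + x\<^sup>2) * ln x - arctan x / x = ln x / (1 + x\<^sup>2)"
      by (simp add: divide_inverse mult.commute)
    finally have "(?\<Phi> has_field_derivative ln x / (1 + x\<^sup>2)) (at x)" .
    moreover have "((\<lambda>u. u / (1 - u)) has_field_derivative 1 / (1 - u)\<^sup>2) (at u)"
      using u by (auto intro!: derivative_eq_intros simp: divide_simps power2_eq_square)
    ultimately have "((\<lambda>u. ?\<Phi> (u / (1 - u))) has_field_derivative
        ln x / (1 + x\<^sup>2) * (1 / (1 - u)\<^sup>2)) (at u)"
      unfolding x_def by (rule DERIV_chain2[where f = ?\<Phi> and g = "\<lambda>u. u / (1 - u)"])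
    also have "ln x / (1 + x\<^sup>2) * (1 / (1 - u)\<^sup>2) = ln (u / (1 - u)) / (u\<^sup>2 + (1 - u)\<^sup>2)"
    proof -
      have "(1 + x\<^sup>2) * (1 - u)\<^sup>2 = u\<^sup>2 + (1 - u)\<^sup>2"
        using u by (simp add: x_def power_divide distrib_right)
      then show ?thesis by (simp add: x_def flip: divide_divide_eq_left')
    qed
    finally show "((\<lambda>u. ?\<Phi> (u / (1 - u))) has_vector_derivative
        ln (u / (1 - u)) / (u\<^sup>2 + (1 - u)\<^sup>2)) (at u)"
      by (simp add: has_real_derivative_iff_has_vector_derivative)
  qed simp
  then show ?thesis by (simp add: inverse_tangent_integral_1)
qed

text \<open>
  The involution \<open>u \<mapsto> (1 - 2u) / (2(1 - u))\<close> of \<open>[0,1/2]\<close>, which is \<open>v \<mapsto> (1 - v) / (1 + v)\<close> in the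
  coordinate \<open>v = u / (1 - u)\<close>, preserves the density \<open>du / (u\<^sup>2 + (1 - u)\<^sup>2)\<close> and turns
  \<open>2(1 - u)\<^sup>2\<close> into its reciprocal. So the integral is its own negative.
\<close>

lemma log_square_integral:
  "((\<lambda>u. ln (2 * (1 - u)\<^sup>2) / (u\<^sup>2 + (1 - u)\<^sup>2)) has_integral 0) {0..1/2 :: real}"
proof -
  let ?f = "\<lambda>u :: real. ln (2 * (1 - u)\<^sup>2) / (u\<^sup>2 + (1 - u)\<^sup>2)"
  let ?g = "\<lambda>u :: real. (1 - 2 * u) / (2 * (1 - u))"
  let ?g' = "\<lambda>u :: real. - 1 / (2 * (1 - u)\<^sup>2)"
  have pos: "0 < u\<^sup>2 + (1 - u)\<^sup>2" for u :: real
    by (cases "u = 0") (auto simp: add_pos_nonneg)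
  have "continuous_on {0..1/2} ?f"
    using pos by (intro continuous_intros) (auto simp: less_imp_neq[symmetric])
  then have int: "(?f has_integral integral {0..1/2} ?f) {0..1/2}"
    by (intro integrable_integral integrable_continuous_real)
  have "((\<lambda>u. ?g' u *\<^sub>R ?f (?g u)) has_integral
      (integral {?g 0..?g (1/2)} ?f - integral {?g (1/2)..?g 0} ?f)) {0..1/2}"
  proof (rule has_integral_substitution_general[where s = "{}"])
    show "?g ` {0..1/2} \<subseteq> {0..1/2}"
      by (auto simp: field_simps)
    show "(?g has_field_derivative ?g' u) (at u within {0..1/2})" if "u \<in> {0..1/2} - {}" for u
      using that by (auto intro!: derivative_eq_intros simp: divide_simps power2_eq_square)
        (simp add: algebra_simps)
  qed (use \<open>continuous_on {0..1/2} ?f\<close> in \<open>auto intro!: continuous_intros\<close>)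
  also have "integral {?g 0..?g (1/2)} ?f - integral {?g (1/2)..?g 0} ?f = - integral {0..1/2} ?f"
    by simp
  finally have "(?f has_integral - integral {0..1/2} ?f) {0..1/2}"
  proof (rule has_integral_eq[rotated])
    fix u :: real assume u: "u \<in> {0..1/2}"
    have 1: "1 - ?g u = 1 / (2 * (1 - u))"
      using u by (simp add: field_simps)
    have "2 * (1 / (2 * (1 - u)))\<^sup>2 = inverse (2 * (1 - u)\<^sup>2)"
      unfolding power_divide power_mult_distrib using u by (simp add: divide_simps)
    then have 2: "ln (2 * (1 - ?g u)\<^sup>2) = - ln (2 * (1 - u)\<^sup>2)"
      unfolding 1 using u by (simp only:) (rule ln_inverse)
    have 3: "(?g u)\<^sup>2 + (1 - ?g u)\<^sup>2 = (u\<^sup>2 + (1 - u)\<^sup>2) / (2 * (1 - u)\<^sup>2)"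
      unfolding 1 using u by (simp add: power_divide power_mult_distrib divide_simps)
        (simp add: power2_eq_square algebra_simps)
    have "u \<noteq> 1" using u by auto
    then show "?g' u *\<^sub>R ?f (?g u) = ?f u"
      unfolding 2 3 using pos[of u] by simp
  qed
  from has_integral_unique[OF this int] int show ?thesis by simp
qed

text \<open>
  By the symmetry \<open>u \<mapsto> 1 - u\<close> it suffices to integrate over \<open>[0,1/2]\<close>, where
  \<open>2u(1 - u) = (u / (1 - u)) \<cdot> 2(1 - u)\<^sup>2\<close> splits the logarithm into the two integrals above.
\<close>

lemma catalan_integral:
  "((\<lambda>u. - ln (2 * u * (1 - u)) / (1 - 2 * u * (1 - u))) has_integral 2 * catalan_const) {0..1}"
proof -
  let ?f = "\<lambda>u :: real. - ln (2 * u * (1 - u)) / (1 - 2 * u * (1 - u))"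
  have left: "(?f has_integral catalan_const) {0..1/2}"
  proof -
    have "((\<lambda>u. - (ln (u / (1 - u)) / (u\<^sup>2 + (1 - u)\<^sup>2)) - ln (2 * (1 - u)\<^sup>2) / (u\<^sup>2 + (1 - u)\<^sup>2))
        has_integral - (- catalan_const) - 0) {0..1/2}"
      by (intro has_integral_diff has_integral_neg log_ratio_integral log_square_integral)
    \<comment> \<open>At \<open>u = 0\<close> the logarithm takes the conventional value \<open>0\<close>, and the splitting fails there.\<close>
    then have "(?f has_integral - (- catalan_const) - 0) {0..1/2}"
    proof (rule has_integral_spike_finite[of "{0}", rotated 2])
      fix u :: real assume u: "u \<in> {0..1/2} - {0}"
      have "2 * u * (1 - u) = u / (1 - u) * (2 * (1 - u)\<^sup>2)"
        using u by (simp add: power2_eq_square)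
      then have "ln (2 * u * (1 - u)) = ln (u / (1 - u)) + ln (2 * (1 - u)\<^sup>2)"
        using u by (simp only:) (rule ln_mult_pos, auto)
      moreover have "1 - 2 * u * (1 - u) = u\<^sup>2 + (1 - u)\<^sup>2"
        by (simp add: power2_eq_square algebra_simps)
      ultimately show "?f u
          = - (ln (u / (1 - u)) / (u\<^sup>2 + (1 - u)\<^sup>2)) - ln (2 * (1 - u)\<^sup>2) / (u\<^sup>2 + (1 - u)\<^sup>2)"
        by (simp add: diff_divide_distrib)
    qed simp
    then show ?thesis by simp
  qed
  have "((\<lambda>u. ?f (- 1 *\<^sub>R u + 1)) has_integral (1 / \<bar>- 1\<bar> ^ DIM(real)) *\<^sub>R catalan_const)
      ((\<lambda>u. (1 / - 1) *\<^sub>R u + - ((1 / - 1) *\<^sub>R 1)) ` cbox 0 (1/2))"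
    by (rule has_integral_affinity) (use left in auto)
  moreover have "(\<lambda>u :: real. (1 / - 1) *\<^sub>R u + - ((1 / - 1) *\<^sub>R 1)) ` cbox 0 (1/2) = {1/2..1}"
    using image_affinity_atLeastAtMost[of "-1" "1 :: real" 0 "1/2"] by simp
  moreover have "?f (- 1 *\<^sub>R u + 1) = ?f u" for u
    by (simp add: mult.commute mult.left_commute)
  ultimately have right: "(?f has_integral catalan_const) {1/2..1}"
    by simp
  from has_integral_combine[OF _ _ left right] show ?thesis
    by simp
qed

section \<open>Moments of the reciprocal linear kernel\<close>

text \<open>
  \<open>moment k w\<close> is \<open>\<integral> a\<^sup>k / (w + (1 - w) a) da\<close> over \<open>[0,1]\<close>. The recursion comes from
  \<open>(1 - w) a\<^sup>k\<^sup>+\<^sup>1 = a\<^sup>k (w + (1 - w) a) - w a\<^sup>k\<close>. Having the moments as explicit functions of \<open>w\<close> avoids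
  differentiating under the integral sign.
\<close>

primrec moment :: "nat \<Rightarrow> real \<Rightarrow> real" where
  "moment 0 w = - ln w / (1 - w)"
| "moment (Suc k) w = (1 / (real k + 1) - w * moment k w) / (1 - w)"

lemma moment_has_integral:
  assumes "0 < w" "w < 1"
  shows "((\<lambda>a. a ^ k / (w + (1 - w) * a)) has_integral moment k w) {0..1}"
proof (induction k)
  case 0
  have pos: "0 < w + (1 - w) * a" if "a \<in> {0..1}" for a
    using that assms by (simp add: add_pos_nonneg)
  have "((\<lambda>a. 1 / (w + (1 - w) * a)) has_integral
      ln (w + (1 - w) * 1) / (1 - w) - ln (w + (1 - w) * 0) / (1 - w)) {0..1}"
  proof (rule fundamental_theorem_of_calculus)
    fix a :: real assume "a \<in> {0..1}"
    from pos[OF this] assms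
    have "((\<lambda>a. ln (w + (1 - w) * a) / (1 - w)) has_field_derivative 1 / (w + (1 - w) * a))
        (at a within {0..1})"
      by (auto intro!: derivative_eq_intros simp: divide_simps)
    then show "((\<lambda>a. ln (w + (1 - w) * a) / (1 - w)) has_vector_derivative 1 / (w + (1 - w) * a))
        (at a within {0..1})"
      by (simp add: has_real_derivative_iff_has_vector_derivative)
  qed simp
  then show ?case by simp
next
  case (Suc k)
  have "((\<lambda>a :: real. a ^ k) has_integral 1 / (real k + 1)) {0..1}"
  proof -
    have "((\<lambda>a :: real. a ^ k) has_integral 1 ^ Suc k / (real k + 1) - 0 ^ Suc k / (real k + 1)) {0..1}"
    proof (rule fundamental_theorem_of_calculus)
      fix a :: real
      have "((\<lambda>a. a ^ Suc k / (real k + 1)) has_field_derivative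
          real (Suc k) * a ^ (Suc k - Suc 0) / (real k + 1)) (at a within {0..1})"
        by (intro DERIV_cdivide DERIV_pow)
      then show "((\<lambda>a. a ^ Suc k / (real k + 1)) has_vector_derivative a ^ k) (at a within {0..1})"
        by (simp add: has_real_derivative_iff_has_vector_derivative add.commute del: power_Suc)
    qed simp
    then show ?thesis by simp
  qed
  from has_integral_divide[OF has_integral_diff[OF this has_integral_mult_right[OF Suc, of w]],
      of "1 - w"]
  have "((\<lambda>a. (a ^ k - w * (a ^ k / (w + (1 - w) * a))) / (1 - w)) has_integral moment (Suc k) w)
      {0..1}"
    by simp
  then show ?case
  proof (rule has_integral_eq[rotated])
    fix a :: real assume "a \<in> {0..1}"
    then have "0 < w + (1 - w) * a" using assms by (simp add: add_pos_nonneg)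
    then show "(a ^ k - w * (a ^ k / (w + (1 - w) * a))) / (1 - w) = a ^ Suc k / (w + (1 - w) * a)"
      using assms by (simp add: divide_simps) (simp add: algebra_simps)
  qed
qed

lemma moment_Suc_deriv:
  assumes "(moment k has_field_derivative d) (at w)" "w \<noteq> 1"
  shows "(moment (Suc k) has_field_derivative (moment (Suc k) w - moment k w - w * d) / (1 - w)) (at w)"
proof -
  have "moment (Suc k) = (\<lambda>w. (1 / (real k + 1) - w * moment k w) / (1 - w))"
    by (rule ext) simp
  then have "(moment (Suc k) has_field_derivative
      ((0 - (1 * moment k w + d * w)) * (1 - w) - (1 / (real k + 1) - w * moment k w) * (0 - 1))
        / ((1 - w) * (1 - w))) (at w)"
    using assms by (simp only:) (intro derivative_intros DERIV_divide DERIV_mult DERIV_diff, auto)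
  also have "((0 - (1 * moment k w + d * w)) * (1 - w) - (1 / (real k + 1) - w * moment k w) * (0 - 1))
        / ((1 - w) * (1 - w)) = (moment (Suc k) w - moment k w - w * d) / (1 - w)"
  proof -
    have "1 / (real k + 1) - w * moment k w = moment (Suc k) w * (1 - w)"
      using assms by simp
    then show ?thesis
      using assms by (simp add: divide_simps del: moment.simps)
  qed
  finally show ?thesis .
qed

text \<open>
  Differentiating under the integral gives \<open>- \<integral> a\<^sup>k\<^sup>+\<^sup>1 (1 - a) / (w + (1 - w) a)\<^sup>2 da\<close>, and an
  integration by parts in \<open>a\<close> turns this into the moments on the right. The proof by induction
  needs only the recursion.
\<close>

lemma moment_deriv:
  assumes "0 < w" "w < 1"
  shows "(moment (Suc k) has_field_derivative
    ((real k + 2) * moment (Suc k) w - (real k + 1) * moment k w) / (1 - w)) (at w)"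
proof (induction k)
  case 0
  have "moment 0 = (\<lambda>w. - ln w / (1 - w))"
    by (rule ext) simp
  then have "(moment 0 has_field_derivative
      (- (1 / w) * (1 - w) - (- ln w) * (0 - 1)) / ((1 - w) * (1 - w))) (at w)"
    using assms by (simp only:) (intro DERIV_divide DERIV_minus DERIV_ln_divide DERIV_diff DERIV_const DERIV_ident, auto)
  moreover have "(- (1 / w) * (1 - w) - (- l) * (0 - 1)) / ((1 - w) * (1 - w))
      = (- l / (1 - w) - 1 / w) / (1 - w)" for l
    using assms by (simp add: divide_simps)
  ultimately have "(moment 0 has_field_derivative (moment 0 w - 1 / w) / (1 - w)) (at w)"
    by simp
  from moment_Suc_deriv[OF this] assms
  have "(moment (Suc 0) has_field_derivative
      (moment (Suc 0) w - moment 0 w - w * ((moment 0 w - 1 / w) / (1 - w))) / (1 - w)) (at w)"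
    by simp
  also have "moment (Suc 0) w - moment 0 w - w * ((moment 0 w - 1 / w) / (1 - w))
      = (real 0 + 2) * moment (Suc 0) w - (real 0 + 1) * moment 0 w"
  proof -
    have "w * ((m - 1 / w) / (1 - w)) = - ((1 - w * m) / (1 - w))" for m
      using assms by (simp add: field_simps)
    then show ?thesis by simp
  qed
  finally show ?case .
next
  case (Suc k)
  define A B C where "A = moment k w" and "B = moment (Suc k) w" and "C = moment (Suc (Suc k)) w"
  have A: "(real k + 1) * (w * A) = 1 - (real k + 1) * ((1 - w) * B)"
    using assms by (simp add: A_def B_def) (simp add: divide_simps)
  have C: "(real k + 2) * ((1 - w) * C) = 1 - (real k + 2) * (w * B)"
  proof -
    have "(1 - w) * C = 1 / (real k + 2) - w * B"
      using assms unfolding C_def B_def moment.simps(2)[of "Suc k"] by (simp add: add.commute del: moment.simps)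
    then show ?thesis by (simp add: right_diff_distrib)
  qed
  have "w * ((real k + 2) * B - (real k + 1) * A) = ((real k + 1) * B - (real k + 2) * C) * (1 - w)"
    using A C by algebra
  then have eq: "w * (((real k + 2) * B - (real k + 1) * A) / (1 - w)) = (real k + 1) * B - (real k + 2) * C"
    using assms by (simp add: divide_eq_eq)
  from moment_Suc_deriv[OF Suc] assms
  have "(moment (Suc (Suc k)) has_field_derivative
      (C - B - w * (((real k + 2) * B - (real k + 1) * A) / (1 - w))) / (1 - w)) (at w)"
    by (simp add: A_def B_def C_def del: moment.simps)
  also have "C - B - w * (((real k + 2) * B - (real k + 1) * A) / (1 - w))
      = (real (Suc k) + 2) * C - (real (Suc k) + 1) * B"
    unfolding eq by (simp add: algebra_simps)
  finally show ?case by (simp only: A_def B_def C_def)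
qed

text \<open>
  Only \<open>moment 0\<close> is unbounded near \<open>w = 0\<close>, and it enters the next moment with the factor \<open>w\<close>.
\<close>

lemma continuous_on_moment: "continuous_on {0..1/2} (moment (Suc k))"
proof (induction k)
  case 0
  have "continuous_on {0..1/2} (\<lambda>w :: real. (1 - - (w * ln w) / (1 - w)) / (1 - w))"
    by (intro continuous_intros continuous_on_subset[OF continuous_on_times_ln]) auto
  then show ?case by simp
next
  case (Suc k)
  then have "continuous_on {0..1/2} (\<lambda>w. (1 / (real (Suc k) + 1) - w * moment (Suc k) w) / (1 - w))"
    by (intro continuous_intros) auto
  then show ?case by (simp only: moment.simps(2)[of "Suc k"])
qed

lemma weight_in_half_interval: "u \<in> {0..1} \<Longrightarrow> 2 * u * (1 - u) \<in> {0..1/2 :: real}"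
proof -
  assume u: "u \<in> {0..1}"
  have "0 \<le> (2 * u - 1)\<^sup>2" by simp
  then have "2 * u * (1 - u) \<le> 1/2" by (simp add: power2_eq_square algebra_simps)
  with u show ?thesis by simp
qed

lemma weight_in_open_unit_interval: "u \<in> {0<..<1} \<Longrightarrow> 0 < 2 * u * (1 - u) \<and> 2 * u * (1 - u) < (1 :: real)"
  using weight_in_half_interval[of u] by auto

lemma continuous_on_moment_comp:
  "continuous_on {0..1} (\<lambda>u. moment (Suc k) (2 * u * (1 - u)))"
proof (rule continuous_on_compose2[OF continuous_on_moment])
  show "continuous_on {0..1} (\<lambda>u :: real. 2 * u * (1 - u))"
    by (intro continuous_intros)
  show "(\<lambda>u :: real. 2 * u * (1 - u)) ` {0..1} \<subseteq> {0..1/2}"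
    using weight_in_half_interval by blast
qed

text \<open>
  For \<open>w = 2u(1 - u)\<close> one has \<open>(2u - 1)\<^sup>2 = 1 - 2w\<close>. With the derivative of the moments this yields
  \<open>d/du ((2u - 1) m\<^sub>k\<^sub>+\<^sub>1(w)) = 2(k + 1) m\<^sub>k(w) - 2(k + 2) m\<^sub>k\<^sub>+\<^sub>2(w)\<close>, so the integrals of moments whose
  indices differ by two determine each other up to a rational boundary term. The relation is the
  trace of the differential equation
  \<open>(1 - a\<^sup>2) dM/da = a M - 1/a\<close> satisfied by \<open>M(a) = \<integral> 1 / (w + (1 - w) a) du\<close>.
\<close>

lemma moment_integral_step:
  assumes "((\<lambda>u. moment k (2 * u * (1 - u))) has_integral L) {0..1}"
  shows "((\<lambda>u. moment (Suc (Suc k)) (2 * u * (1 - u))) has_integral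
    ((real k + 1) * L - 1 / (real k + 1)) / (real k + 2)) {0..1}"
proof -
  let ?w = "\<lambda>u :: real. 2 * u * (1 - u)"
  let ?G = "\<lambda>u. (2 * u - 1) * moment (Suc k) (?w u)"
  let ?G' = "\<lambda>u. 2 * (real k + 1) * moment k (?w u) - 2 * (real k + 2) * moment (Suc (Suc k)) (?w u)"
  have "(?G' has_integral ?G 1 - ?G 0) {0..1}"
  proof (rule fundamental_theorem_of_calculus_interior)
    show "continuous_on {0..1} ?G"
      by (intro continuous_intros continuous_on_moment_comp)
  next
    fix u :: real assume u: "u \<in> {0<..<1}"
    define w A B C where "w = ?w u" and "A = moment k w" and "B = moment (Suc k) w"
      and "C = moment (Suc (Suc k)) w"
    have w: "0 < w" "w < 1" using weight_in_open_unit_interval[OF u] by (auto simp: w_def)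
    have A: "(real k + 1) * (w * A) = 1 - (real k + 1) * ((1 - w) * B)"
      using w by (simp add: A_def B_def) (simp add: divide_simps)
    have C: "(real k + 2) * ((1 - w) * C) = 1 - (real k + 2) * (w * B)"
    proof -
      have "(1 - w) * C = 1 / (real k + 2) - w * B"
        using w unfolding C_def B_def moment.simps(2)[of "Suc k"]
        by (simp add: add.commute del: moment.simps)
      then show ?thesis by (simp add: right_diff_distrib)
    qed
    have "(?w has_field_derivative 2 - 4 * u) (at u)"
      by (auto intro!: derivative_eq_intros)
    from DERIV_chain2[OF moment_deriv[OF w, unfolded w_def] this]
    have "((\<lambda>u. moment (Suc k) (?w u)) has_field_derivative
        ((real k + 2) * B - (real k + 1) * A) / (1 - w) * (2 - 4 * u)) (at u)"
      by (simp only: A_def B_def w_def)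
    then have "(?G has_field_derivative
        (2 * 1 - 0) * B + ((real k + 2) * B - (real k + 1) * A) / (1 - w) * (2 - 4 * u) * (2 * u - 1)) (at u)"
      unfolding B_def w_def
      by (intro DERIV_mult DERIV_diff DERIV_cmult DERIV_ident DERIV_const)
    also have "(2 * 1 - 0) * B + ((real k + 2) * B - (real k + 1) * A) / (1 - w) * (2 - 4 * u) * (2 * u - 1)
        = 2 * B - 2 * (1 - 2 * w) * (((real k + 2) * B - (real k + 1) * A) / (1 - w))"
    proof -
      have "(2 * 1 - 0) * B + Q * (2 - 4 * u) * (2 * u - 1) = 2 * B - 2 * (1 - 2 * w) * Q" for Q
        by (simp add: w_def algebra_simps)
      then show ?thesis .
    qed
    also have "\<dots> = 2 * (real k + 1) * A - 2 * (real k + 2) * C"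
    proof -
      have "(1 - 2 * w) * ((real k + 2) * B - (real k + 1) * A)
          = (B - (real k + 1) * A + (real k + 2) * C) * (1 - w)"
        using A C by algebra
      then have "(1 - 2 * w) * (((real k + 2) * B - (real k + 1) * A) / (1 - w))
          = B - (real k + 1) * A + (real k + 2) * C"
        using w by (simp add: divide_eq_eq)
      then show ?thesis by algebra
    qed
    finally show "(?G has_vector_derivative ?G' u) (at u)"
      by (simp add: has_real_derivative_iff_has_vector_derivative A_def C_def w_def del: moment.simps)
  qed simp
  moreover have "?G 1 - ?G 0 = 2 / (real k + 1)"
    by simp
  ultimately have G: "(?G' has_integral 2 / (real k + 1)) {0..1}"
    by (simp only:)
  have "((\<lambda>u. (2 * (real k + 1) * moment k (?w u) - ?G' u) / (2 * (real k + 2))) has_integral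
      (2 * (real k + 1) * L - 2 / (real k + 1)) / (2 * (real k + 2))) {0..1}"
    by (intro has_integral_divide has_integral_diff has_integral_mult_right assms G)
  moreover have "(2 * (real k + 1) * moment k (?w u) - ?G' u) / (2 * (real k + 2))
      = moment (Suc (Suc k)) (?w u)" for u
    by (simp del: moment.simps add: add_eq_0_iff)
  moreover have "(2 * (real k + 1) * L - 2 / (real k + 1)) / (2 * (real k + 2))
      = ((real k + 1) * L - 1 / (real k + 1)) / (real k + 2)"
    using mult_divide_mult_cancel_left[of 2 "(real k + 1) * L - 1 / (real k + 1)" "real k + 2"]
    by (simp add: algebra_simps)
  ultimately show ?thesis by (simp only:)
qed

section \<open>Rational combinations of 1 and the Catalan constant\<close>

definition catalan_span :: "real set" where
  "catalan_span = {of_rat a + of_rat b * catalan_const | a b :: rat. True}"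

lemma catalan_span_add: "x \<in> catalan_span \<Longrightarrow> y \<in> catalan_span \<Longrightarrow> x + y \<in> catalan_span"
proof -
  assume "x \<in> catalan_span" "y \<in> catalan_span"
  then obtain a b c d where "x = of_rat a + of_rat b * catalan_const" "y = of_rat c + of_rat d * catalan_const"
    by (auto simp: catalan_span_def)
  then have "x + y = of_rat (a + c) + of_rat (b + d) * catalan_const"
    by (simp add: of_rat_add algebra_simps)
  then show ?thesis unfolding catalan_span_def by blast
qed

lemma catalan_span_rat: "of_rat r \<in> catalan_span"
  unfolding catalan_span_def by (intro CollectI exI[of _ r] exI[of _ 0]) simp

lemma catalan_span_scale: "x \<in> catalan_span \<Longrightarrow> of_rat r * x \<in> catalan_span"
proof -
  assume "x \<in> catalan_span"
  then obtain a b where "x = of_rat a + of_rat b * catalan_const"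
    by (auto simp: catalan_span_def)
  then have "of_rat r * x = of_rat (r * a) + of_rat (r * b) * catalan_const"
    by (simp add: of_rat_mult algebra_simps)
  then show ?thesis unfolding catalan_span_def by blast
qed

lemma catalan_span_sum: "(\<And>i. i \<in> I \<Longrightarrow> f i \<in> catalan_span) \<Longrightarrow> sum f I \<in> catalan_span"
  by (induction I rule: infinite_finite_induct)
    (auto intro: catalan_span_add catalan_span_rat[of 0, simplified])

lemma even_moment_integral:
  "\<exists>L\<in>catalan_span. ((\<lambda>u. moment (2 * j) (2 * u * (1 - u))) has_integral L) {0..1}"
proof (induction j)
  case 0
  have "2 * catalan_const \<in> catalan_span"
    unfolding catalan_span_def by (intro CollectI exI[of _ 0] exI[of _ 2]) simp
  with catalan_integral show ?case by auto
next
  case (Suc j)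
  then obtain L where L: "L \<in> catalan_span"
    "((\<lambda>u. moment (2 * j) (2 * u * (1 - u))) has_integral L) {0..1}" by blast
  let ?r = "of_nat (2 * j) :: rat"
  have "((real (2 * j) + 1) * L - 1 / (real (2 * j) + 1)) / (real (2 * j) + 2)
      = of_rat ((?r + 1) / (?r + 2)) * L + of_rat (- 1 / ((?r + 1) * (?r + 2)))"
    by (simp add: of_rat_divide of_rat_add of_rat_mult of_rat_minus diff_divide_distrib)
  also have "\<dots> \<in> catalan_span"
    by (intro catalan_span_add catalan_span_scale catalan_span_rat L)
  finally show ?case
    using moment_integral_step[OF L(2)] by (intro bexI) simp_all
qed

text \<open>
  These are Beta integrals. The derivative of \<open>(2u - 1) w\<^sup>n\<^sup>+\<^sup>1\<close> is a combination of \<open>w\<^sup>n\<^sup>+\<^sup>1\<close> and \<open>w\<^sup>n\<close>, and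
  the function vanishes at both ends, which gives a recursion with rational coefficients.
\<close>

lemma weight_power_integral:
  "\<exists>b :: rat. ((\<lambda>u :: real. (2 * u * (1 - u)) ^ n) has_integral of_rat b) {0..1}"
proof (induction n)
  case 0
  show ?case
    using has_integral_const_real[of "1 :: real" 0 1] by (intro exI[of _ 1]) simp
next
  case (Suc n)
  then obtain b :: rat where b: "((\<lambda>u :: real. (2 * u * (1 - u)) ^ n) has_integral of_rat b) {0..1}"
    by blast
  let ?w = "\<lambda>u :: real. 2 * u * (1 - u)"
  let ?G' = "\<lambda>u. 2 * (2 * real n + 3) * ?w u ^ Suc n - 2 * (real n + 1) * ?w u ^ n"
  have "(?G' has_integral (2 * 1 - 1) * ?w 1 ^ Suc n - (2 * 0 - 1) * ?w 0 ^ Suc n) {0..1}"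
  proof (rule fundamental_theorem_of_calculus)
    fix u :: real
    have "(?w has_field_derivative 2 - 4 * u) (at u within {0..1})"
      by (auto intro!: derivative_eq_intros)
    then have "((\<lambda>u. (2 * u - 1) * ?w u ^ Suc n) has_field_derivative
        (2 * 1 - 0) * ?w u ^ Suc n + (1 + of_nat n) * ((2 - 4 * u) * ?w u ^ n) * (2 * u - 1))
        (at u within {0..1})"
      by (intro DERIV_mult DERIV_diff DERIV_cmult DERIV_ident DERIV_const DERIV_power_Suc)
    also have "(2 * 1 - 0) * ?w u ^ Suc n + (1 + of_nat n) * ((2 - 4 * u) * ?w u ^ n) * (2 * u - 1)
        = ?G' u"
    proof -
      have "(2 * 1 - 0) * (?w u * p) + (1 + r) * ((2 - 4 * u) * p) * (2 * u - 1)
        = 2 * (2 * r + 3) * (?w u * p) - 2 * (r + 1) * p" for p r :: real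
        by (simp add: algebra_simps)
      then show ?thesis by simp
    qed
    finally show "((\<lambda>u. (2 * u - 1) * ?w u ^ Suc n) has_vector_derivative ?G' u) (at u within {0..1})"
      by (simp add: has_real_derivative_iff_has_vector_derivative)
  qed simp
  then have G: "(?G' has_integral 0) {0..1}" by simp
  have "((\<lambda>u. (?G' u + 2 * (real n + 1) * ?w u ^ n) / (2 * (2 * real n + 3))) has_integral
      (0 + 2 * (real n + 1) * of_rat b) / (2 * (2 * real n + 3))) {0..1}"
    by (intro has_integral_divide has_integral_add has_integral_mult_right b G)
  moreover have "(?G' u + 2 * (real n + 1) * ?w u ^ n) / (2 * (2 * real n + 3)) = ?w u ^ Suc n" for u
    by simp
  moreover have "(0 + 2 * (real n + 1) * of_rat b) / (2 * (2 * real n + 3))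
      = of_rat (2 * (of_nat n + 1) * b / (2 * (2 * of_nat n + 3)))"
    by (simp add: of_rat_divide of_rat_add of_rat_mult)
  ultimately show ?case by (intro exI) (simp only:)
qed

section \<open>Powers of the kernel\<close>

text \<open>
  \<open>kernel_moment k n w\<close> is \<open>\<integral> a\<^sup>k w\<^sup>n / (w + (1 - w) a)\<^sup>n\<^sup>+\<^sup>1 da\<close> over \<open>[0,1]\<close>. The recursion is the
  integral of the derivative of \<open>a\<^sup>k\<^sup>+\<^sup>1 w\<^sup>n / (w + (1 - w) a)\<^sup>n\<^sup>+\<^sup>1\<close>, whose boundary term at \<open>a = 1\<close> is \<open>w\<^sup>n\<close>.
\<close>

primrec kernel_moment :: "nat \<Rightarrow> nat \<Rightarrow> real \<Rightarrow> real" where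
  "kernel_moment k 0 w = moment k w"
| "kernel_moment k (Suc n) w = (w ^ n + (real n - real k) * kernel_moment k n w) / (real n + 1)"

lemma kernel_moment_has_integral:
  assumes "0 < w" "w < 1"
  shows "((\<lambda>a. a ^ k * w ^ n / (w + (1 - w) * a) ^ Suc n) has_integral kernel_moment k n w) {0..1}"
proof (induction n)
  case 0
  from moment_has_integral[OF assms] show ?case by simp
next
  case (Suc n)
  let ?N = "\<lambda>a. w + (1 - w) * a"
  let ?h = "\<lambda>n a. a ^ k * w ^ n / ?N a ^ Suc n"
  let ?g' = "\<lambda>a. (real n + 1) * ?h (Suc n) a - (real n - real k) * ?h n a"
  have N: "0 < ?N a" if "a \<in> {0..1}" for a
    using that assms by (simp add: add_pos_nonneg)
  have "(?g' has_integral 1 ^ Suc k * w ^ n / ?N 1 ^ Suc n - 0 ^ Suc k * w ^ n / ?N 0 ^ Suc n) {0..1}"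
  proof (rule fundamental_theorem_of_calculus)
    fix a :: real assume a: "a \<in> {0..1}"
    note N = N[OF a]
    have "(?N has_field_derivative 0 + (1 - w) * 1) (at a within {0..1})"
      by (intro DERIV_add DERIV_const DERIV_cmult DERIV_ident)
    then have "((\<lambda>a. a ^ Suc k * w ^ n / ?N a ^ Suc n) has_field_derivative
        (((1 + of_nat k) * (1 * a ^ k) * w ^ n) * ?N a ^ Suc n
          - (a ^ Suc k * w ^ n) * ((1 + of_nat n) * ((0 + (1 - w) * 1) * ?N a ^ n)))
          / (?N a ^ Suc n * ?N a ^ Suc n)) (at a within {0..1})"
      using N by (intro DERIV_divide DERIV_cmult_right DERIV_power_Suc DERIV_ident) auto
    also have "(((1 + of_nat k) * (1 * a ^ k) * w ^ n) * ?N a ^ Suc n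
          - (a ^ Suc k * w ^ n) * ((1 + of_nat n) * ((0 + (1 - w) * 1) * ?N a ^ n)))
          / (?N a ^ Suc n * ?N a ^ Suc n) = ?g' a"
    proof -
      \<comment> \<open>Here \<open>p\<close>, \<open>q\<close>, \<open>M\<close> stand for the powers of \<open>a\<close>, \<open>w\<close> and \<open>m = w + (1 - w) a\<close>.\<close>
      have *: "(((1 + r) * (1 * p) * q) * (m * M) - (a * p * q) * ((1 + s) * ((0 + (1 - w) * 1) * M)))
          / ((m * M) * (m * M)) = (s + 1) * (p * (w * q) / (m * (m * M))) - (s - r) * (p * q / (m * M))"
        if "m = ?N a" "m \<noteq> 0" "M \<noteq> 0" for r p q m M s
      proof -
        have "(1 - w) * a = m - w" using that by simp
        then have "(((1 + r) * (1 * p) * q) * (m * M) - (a * p * q) * ((1 + s) * ((0 + (1 - w) * 1) * M)))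
            = ((s + 1) * (p * (w * q)) - (s - r) * (p * q) * m) * M"
          by algebra
        then show ?thesis using that(2,3) by (simp add: divide_simps)
      qed
      show ?thesis using N by (simp only: power_Suc) (intro *, auto)
    qed
    finally show "((\<lambda>a. a ^ Suc k * w ^ n / ?N a ^ Suc n) has_vector_derivative ?g' a)
        (at a within {0..1})"
      by (simp only: has_real_derivative_iff_has_vector_derivative)
  qed simp
  then have g: "(?g' has_integral w ^ n) {0..1}" by simp
  have "((\<lambda>a. (?g' a + (real n - real k) * ?h n a) / (real n + 1)) has_integral
      (w ^ n + (real n - real k) * kernel_moment k n w) / (real n + 1)) {0..1}"
    by (intro has_integral_divide has_integral_add has_integral_mult_right g Suc)
  moreover have "(?g' a + (real n - real k) * ?h n a) / (real n + 1) = ?h (Suc n) a" for a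
    by (simp add: add_eq_0_iff)
  ultimately show ?case by (simp only: kernel_moment.simps)
qed

lemma kernel_moment_integrable:
  "(\<lambda>u. kernel_moment k n (2 * u * (1 - u))) integrable_on {0..1}"
proof (induction n)
  case 0
  show ?case
  proof (cases k)
    case 0
    with catalan_integral show ?thesis by (auto simp: integrable_on_def)
  next
    case (Suc l)
    then show ?thesis
      using integrable_continuous_real[OF continuous_on_moment_comp[of l]] by simp
  qed
next
  case (Suc n)
  obtain b :: rat where "((\<lambda>u :: real. (2 * u * (1 - u)) ^ n) has_integral of_rat b) {0..1}"
    using weight_power_integral by blast
  from has_integral_divide[OF has_integral_add[OF this
        has_integral_mult_right[OF integrable_integral[OF Suc]]]]
  show ?case unfolding kernel_moment.simps integrable_on_def by blast
qed

lemma kernel_moment_integral: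
  assumes "even k"
  shows "integral {0..1} (\<lambda>u. kernel_moment k n (2 * u * (1 - u))) \<in> catalan_span"
proof (induction n)
  case 0
  from assms obtain j where "k = 2 * j" by (auto elim: evenE)
  with even_moment_integral[of j] show ?case
    by (auto simp: integral_unique)
next
  case (Suc n)
  let ?I = "integral {0..1} (\<lambda>u. kernel_moment k n (2 * u * (1 - u)))"
  obtain b :: rat where "((\<lambda>u :: real. (2 * u * (1 - u)) ^ n) has_integral of_rat b) {0..1}"
    using weight_power_integral by blast
  from has_integral_divide[OF has_integral_add[OF this
        has_integral_mult_right[OF integrable_integral[OF kernel_moment_integrable[of k n]]]],
      of "real n - real k" "real n + 1"]
  have "integral {0..1} (\<lambda>u. kernel_moment k (Suc n) (2 * u * (1 - u)))
      = (of_rat b + (real n - real k) * ?I) / (real n + 1)"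
    unfolding kernel_moment.simps by (rule integral_unique)
  also have "\<dots> = of_rat (b / (of_nat n + 1))
      + of_rat ((of_nat n - of_nat k) / (of_nat n + 1)) * ?I"
    by (simp add: of_rat_divide of_rat_add of_rat_diff add_divide_distrib)
  also have "\<dots> \<in> catalan_span"
    by (intro catalan_span_add catalan_span_scale catalan_span_rat Suc)
  finally show ?case .
qed

section \<open>The integral over the triangle\<close>

text \<open>
  On the ray in direction \<open>(u, 1 - u)\<close> one has \<open>D = 1 - (1 - w) l\<^sup>2\<close> and \<open>xy = w l\<^sup>2 / 2\<close>. The variable
  \<open>a = w l\<^sup>2 / D\<close> runs through \<open>[0,1]\<close> along with \<open>l\<close>, and \<open>w + (1 - w) a = w / D\<close>, so every factor of the
  integrand is a power of \<open>a\<close>, of \<open>w\<close> or of the kernel. The hypothesis on \<open>t\<close> says that the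
  exponent \<open>n\<close> is not negative.
\<close>

lemma radial_integral:
  assumes w: "0 < w" "w < 1" and t: "t \<le> i + k"
  shows "((\<lambda>l. l * ((1 - (1 - w) * l\<^sup>2) ^ i * (w / 2 * l\<^sup>2) ^ k / (1 - (1 - w) * l\<^sup>2) ^ Suc t))
    has_integral kernel_moment k (i + k - t) w / 2 ^ Suc k) {0..1}"
proof -
  define n where "n = i + k - t"
  let ?D = "\<lambda>l :: real. 1 - (1 - w) * l\<^sup>2"
  let ?N = "\<lambda>a :: real. w + (1 - w) * a"
  let ?f = "\<lambda>a. a ^ k * w ^ n / ?N a ^ Suc n"
  let ?g = "\<lambda>l. l\<^sup>2 * w / ?D l"
  let ?g' = "\<lambda>l. 2 * l * w / (?D l)\<^sup>2"
  have D: "w \<le> ?D l" if "l \<in> {0..1}" for l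
  proof -
    have "l\<^sup>2 \<le> 1" using that by (simp add: power_le_one)
    with w have "(1 - w) * l\<^sup>2 \<le> (1 - w) * 1" by (intro mult_left_mono) auto
    then show ?thesis by simp
  qed
  have N: "0 < ?N a" if "a \<in> {0..1}" for a
    using that w by (simp add: add_pos_nonneg)
  have "((\<lambda>l. ?g' l *\<^sub>R ?f (?g l)) has_integral (integral {?g 0..?g 1} ?f)) {0..1}"
  proof (rule has_integral_substitution)
    show "?g ` {0..1} \<subseteq> {0..1}"
    proof safe
      fix l :: real assume l: "l \<in> {0..1}"
      then have "l\<^sup>2 \<le> 1" by (simp add: power_le_one)
      then have "l\<^sup>2 * w \<le> ?D l" by (simp add: algebra_simps)
      with D[OF l] w show "?g l \<in> {0..1}" by simp
    qed
    show "continuous_on {0..1} ?f"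
      using N by (intro continuous_intros) (auto simp: less_imp_neq[symmetric])
    show "(?g has_field_derivative ?g' l) (at l within {0..1})" if l: "l \<in> {0..1}" for l
    proof -
      have "((\<lambda>l. l\<^sup>2 * w) has_field_derivative 2 * l * w) (at l within {0..1})"
        "(?D has_field_derivative - ((1 - w) * (2 * l))) (at l within {0..1})"
        by (auto intro!: derivative_eq_intros)
      then have "(?g has_field_derivative
          (2 * l * w * ?D l - l\<^sup>2 * w * (- ((1 - w) * (2 * l)))) / (?D l * ?D l)) (at l within {0..1})"
        using D[OF l] w by (intro DERIV_divide) auto
      also have "2 * l * w * ?D l - l\<^sup>2 * w * (- ((1 - w) * (2 * l))) = 2 * l * w"
        by (simp add: power2_eq_square algebra_simps)
      finally show ?thesis by (simp add: power2_eq_square)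
    qed
  qed (use w in auto)
  also have "integral {?g 0..?g 1} ?f = kernel_moment k n w"
    using integral_unique[OF kernel_moment_has_integral[OF w, of k n]] w by simp
  finally have "((\<lambda>l. ?g' l *\<^sub>R ?f (?g l) / 2 ^ Suc k) has_integral kernel_moment k n w / 2 ^ Suc k) {0..1}"
    by (rule has_integral_divide)
  then show ?thesis unfolding n_def[symmetric]
  proof (rule has_integral_eq[rotated])
    fix l :: real assume l: "l \<in> {0..1}"
    define d where "d = ?D l"
    have d: "0 < d" using D[OF l] w by (simp add: d_def)
    have "?N (?g l) = w / d"
    proof -
      have "?N (?g l) = (w * d + (1 - w) * (l\<^sup>2 * w)) / d"
        using d by (simp add: d_def[symmetric] add_divide_distrib)
      also have "w * d + (1 - w) * (l\<^sup>2 * w) = w"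
        by (simp add: d_def algebra_simps)
      finally show ?thesis .
    qed
    then have "?g' l *\<^sub>R ?f (?g l) / 2 ^ Suc k
        = 2 * l * w / d\<^sup>2 * ((l\<^sup>2 * w / d) ^ k * w ^ n / (w / d) ^ Suc n) / 2 ^ Suc k"
      by (simp only: d_def[symmetric] real_scaleR_def)
    also have "\<dots> = l * ((w / 2 * l\<^sup>2) ^ k * (d ^ Suc n / d ^ (k + 2)))"
      using w d by (simp add: power_divide power_mult_distrib power_add power2_eq_square)
        (simp add: field_simps)
    also have "d ^ Suc n / d ^ (k + 2) = d ^ i / d ^ Suc t"
    proof -
      have "Suc n + Suc t = i + (k + 2)" using t by (simp add: n_def)
      then have "d ^ Suc n * d ^ Suc t = d ^ i * d ^ (k + 2)" by (simp only: flip: power_add)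
      then show ?thesis using d by (simp add: frac_eq_eq del: power_Suc)
    qed
    finally show "?g' l *\<^sub>R ?f (?g l) / 2 ^ Suc k
        = l * (?D l ^ i * (w / 2 * l\<^sup>2) ^ k / ?D l ^ Suc t)"
      by (simp add: d_def mult_ac)
  qed
qed

lemma closed_unit_triangle: "closed unit_triangle"
proof -
  have "unit_triangle = {z. 0 \<le> fst z} \<inter> {z. 0 \<le> snd z} \<inter> {z. 0 \<le> 1 - fst z - snd z}"
    by (auto simp: unit_triangle_def)
  then show ?thesis
    by (rule ssubst) (intro closed_Int closed_Collect_le continuous_intros)
qed

lemma unit_triangle_measurable [measurable]: "unit_triangle \<in> sets borel"
  using closed_unit_triangle by (rule borel_closed)

text \<open>
  The coordinates are \<open>l = x + y\<close> and \<open>u = x / l\<close>, with Jacobian \<open>l\<close>: a shear in \<open>y\<close>, then a dilation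
  in \<open>x\<close>. For nonnegative functions the order of integration can be changed before anything is
  known about convergence.
\<close>

lemma unit_triangle_nn_integral:
  fixes f :: "real \<times> real \<Rightarrow> ennreal"
  assumes [measurable]: "f \<in> borel_measurable borel"
  shows "(\<integral>\<^sup>+z. f z * indicator unit_triangle z \<partial>lborel)
    = (\<integral>\<^sup>+u. (\<integral>\<^sup>+l. ennreal l * f (l * u, l * (1 - u)) * indicator {0..1} l \<partial>lborel)
        * indicator {0..1} u \<partial>lborel)"
proof -
  define G where "G z = f z * indicator unit_triangle z" for z
  have G [measurable]: "G \<in> borel_measurable borel"
    unfolding G_def by measurable
  have G_comp [measurable (raw)]: "(\<lambda>z. G (p z, q z)) \<in> borel_measurable M"
    if "p \<in> borel_measurable M" "q \<in> borel_measurable M" for p q and M :: "'b measure"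
    using that by (intro measurable_compose[OF _ G] borel_measurable_Pair)
  have f_comp [measurable (raw)]: "(\<lambda>z. f (p z, q z)) \<in> borel_measurable M"
    if "p \<in> borel_measurable M" "q \<in> borel_measurable M" for p q and M :: "'b measure"
    using that by (intro measurable_compose[OF _ assms] borel_measurable_Pair)
  have "(\<integral>\<^sup>+z. G z \<partial>lborel) = (\<integral>\<^sup>+x. \<integral>\<^sup>+y. G (x, y) \<partial>lborel \<partial>lborel)"
    using lborel.nn_integral_fst[of G lborel] by (simp add: lborel_prod)
  also have "\<dots> = (\<integral>\<^sup>+x. \<integral>\<^sup>+l. G (x, l - x) \<partial>lborel \<partial>lborel)"
  proof (rule nn_integral_cong)
    fix x :: real
    show "(\<integral>\<^sup>+y. G (x, y) \<partial>lborel) = (\<integral>\<^sup>+l. G (x, l - x) \<partial>lborel)"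
      using nn_integral_real_affine[of "\<lambda>y. G (x, y)" 1 "- x"] by (simp add: algebra_simps)
  qed
  also have "\<dots> = (\<integral>\<^sup>+l. \<integral>\<^sup>+x. G (x, l - x) \<partial>lborel \<partial>lborel)"
    by (rule lborel_pair.Fubini') measurable
  also have "\<dots> = (\<integral>\<^sup>+l. \<integral>\<^sup>+u. ennreal l * f (l * u, l * (1 - u)) * indicator {0..1} l
      * indicator {0..1} u \<partial>lborel \<partial>lborel)"
  proof (rule nn_integral_cong_AE, rule AE_mp[OF AE_lborel_singleton[of 0]], intro AE_I2 impI)
    fix l :: real assume l: "l \<noteq> 0"
    have "(\<integral>\<^sup>+x. G (x, l - x) \<partial>lborel) = ennreal \<bar>l\<bar> * (\<integral>\<^sup>+u. G (l * u, l - l * u) \<partial>lborel)"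
      using nn_integral_real_affine[of "\<lambda>x. G (x, l - x)" l 0] l by simp
    also have "\<dots> = (\<integral>\<^sup>+u. ennreal \<bar>l\<bar> * G (l * u, l - l * u) \<partial>lborel)"
      by (intro nn_integral_cmult[symmetric]) measurable
    also have "\<dots> = (\<integral>\<^sup>+u. ennreal l * f (l * u, l * (1 - u)) * indicator {0..1} l
        * indicator {0..1} u \<partial>lborel)"
    proof (intro nn_integral_cong)
      fix u :: real
      show "ennreal \<bar>l\<bar> * G (l * u, l - l * u)
          = ennreal l * f (l * u, l * (1 - u)) * indicator {0..1} l * indicator {0..1} u"
      proof (cases "0 < l")
        case True
        then have "(l * u, l - l * u) \<in> unit_triangle \<longleftrightarrow> l \<in> {0..1} \<and> u \<in> {0..1}"
          by (auto simp: unit_triangle_def zero_le_mult_iff)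
        with True show ?thesis
          by (auto simp: G_def right_diff_distrib indicator_def)
      next
        case False
        with l have "l < 0" by simp
        then have "(l * u, l - l * u) \<notin> unit_triangle"
          by (auto simp: unit_triangle_def zero_le_mult_iff)
        with \<open>l < 0\<close> show ?thesis
          by (simp add: G_def)
      qed
    qed
    finally show "(\<integral>\<^sup>+x. G (x, l - x) \<partial>lborel)
        = (\<integral>\<^sup>+u. ennreal l * f (l * u, l * (1 - u)) * indicator {0..1} l
            * indicator {0..1} u \<partial>lborel)" .
  qed
  also have "\<dots> = (\<integral>\<^sup>+u. \<integral>\<^sup>+l. ennreal l * f (l * u, l * (1 - u)) * indicator {0..1} l
      * indicator {0..1} u \<partial>lborel \<partial>lborel)"
    by (rule lborel_pair.Fubini') measurable
  also have "\<dots> = (\<integral>\<^sup>+u. (\<integral>\<^sup>+l. ennreal l * f (l * u, l * (1 - u)) * indicator {0..1} l \<partial>lborel)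
        * indicator {0..1} u \<partial>lborel)"
    by (intro nn_integral_cong nn_integral_multc) measurable
  finally show ?thesis by (simp add: G_def)
qed

text \<open>
  All terms with even \<open>k\<close> are nonnegative on the triangle, so this computes their integrals. For odd
  \<open>k\<close> it provides an integrable bound.
\<close>

lemma monomial_nn_integral:
  assumes "t \<le> i + k"
  defines "C \<equiv> integral {0..1} (\<lambda>u. kernel_moment k (i + k - t) (2 * u * (1 - u))) / 2 ^ Suc k"
  shows "0 \<le> C"
    and "(\<integral>\<^sup>+z. ennreal (case z of (x, y) \<Rightarrow>
        (1 - x\<^sup>2 - y\<^sup>2) ^ i * (x * y) ^ k / (1 - x\<^sup>2 - y\<^sup>2) ^ Suc t) * indicator unit_triangle z \<partial>lborel)
      = ennreal C"
proof -
  let ?n = "i + k - t"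
  let ?w = "\<lambda>u :: real. 2 * u * (1 - u)"
  let ?h = "\<lambda>z :: real \<times> real. case z of (x, y) \<Rightarrow>
        (1 - x\<^sup>2 - y\<^sup>2) ^ i * (x * y) ^ k / (1 - x\<^sup>2 - y\<^sup>2) ^ Suc t"
  have "((\<lambda>u. kernel_moment k ?n (?w u) / 2 ^ Suc k) has_integral C) {0..1}"
    unfolding C_def by (intro has_integral_divide integrable_integral kernel_moment_integrable)
  \<comment> \<open>At the endpoints \<open>w = 0\<close>, so \<open>kernel_moment\<close> is not an integral there and may be negative.\<close>
  then have outer: "((\<lambda>u. kernel_moment k ?n (?w u) / 2 ^ Suc k) has_integral C) {0<..<1}"
    by (simp only: has_integral_Icc_iff_Ioo)
  have nonneg: "0 \<le> kernel_moment k ?n (?w u) / 2 ^ Suc k" if "u \<in> {0<..<1}" for u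
  proof -
    have w: "0 < ?w u" "?w u < 1" using weight_in_open_unit_interval[OF that] by auto
    have "0 \<le> kernel_moment k ?n (?w u)"
      using kernel_moment_has_integral[OF w]
      by (rule has_integral_nonneg) (use w in \<open>auto intro!: divide_nonneg_nonneg mult_nonneg_nonneg add_nonneg_nonneg zero_le_power\<close>)
    then show ?thesis by simp
  qed
  show "0 \<le> C"
    using outer nonneg by (rule has_integral_nonneg)
  have inner: "(\<integral>\<^sup>+l. ennreal l * ennreal (?h (l * u, l * (1 - u))) * indicator {0..1} l \<partial>lborel)
      = ennreal (kernel_moment k ?n (?w u) / 2 ^ Suc k)" if u: "u \<in> {0<..<1}" for u
  proof -
    define w where "w = ?w u"
    have w: "0 < w" "w < 1" using weight_in_open_unit_interval[OF u] by (auto simp: w_def)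
    let ?r = "\<lambda>l. l * ((1 - (1 - w) * l\<^sup>2) ^ i * (w / 2 * l\<^sup>2) ^ k / (1 - (1 - w) * l\<^sup>2) ^ Suc t)"
    have "1 - (l * u)\<^sup>2 - (l * (1 - u))\<^sup>2 = 1 - (1 - w) * l\<^sup>2"
      "l * u * (l * (1 - u)) = w / 2 * l\<^sup>2" for l
      by (simp_all add: w_def power2_eq_square algebra_simps)
    then have "?h (l * u, l * (1 - u))
        = (1 - (1 - w) * l\<^sup>2) ^ i * (w / 2 * l\<^sup>2) ^ k / (1 - (1 - w) * l\<^sup>2) ^ Suc t" for l
      by (simp only: prod.case)
    then have "(\<integral>\<^sup>+l. ennreal l * ennreal (?h (l * u, l * (1 - u))) * indicator {0..1} l \<partial>lborel)
        = (\<integral>\<^sup>+l. ennreal (?r l) * indicator {0..1} l \<partial>lborel)"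
      by (intro nn_integral_cong) (simp add: indicator_def ennreal_mult'[symmetric])
    also have "\<dots> = ennreal (kernel_moment k ?n w / 2 ^ Suc k)"
    proof (rule nn_integral_has_integral_lebesgue'[OF _ radial_integral[OF w assms(1)]])
      fix l :: real assume l: "l \<in> {0..1}"
      then have "l\<^sup>2 \<le> 1" by (simp add: power_le_one)
      then have "(1 - w) * l\<^sup>2 \<le> 1" using w by (intro mult_le_one) auto
      then show "0 \<le> ?r l"
        using l w by (intro mult_nonneg_nonneg divide_nonneg_nonneg zero_le_power) auto
    qed
    finally show ?thesis by (simp add: w_def)
  qed
  have [measurable]: "?h \<in> borel_measurable borel"
    unfolding borel_prod[symmetric] by measurable
  have "(\<integral>\<^sup>+z. ennreal (?h z) * indicator unit_triangle z \<partial>lborel)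
    = (\<integral>\<^sup>+u. (\<integral>\<^sup>+l. ennreal l * ennreal (?h (l * u, l * (1 - u))) * indicator {0..1} l \<partial>lborel)
        * indicator {0..1} u \<partial>lborel)"
    by (rule unit_triangle_nn_integral) measurable
  also have "\<dots> = (\<integral>\<^sup>+u. ennreal (kernel_moment k ?n (?w u) / 2 ^ Suc k) * indicator {0<..<1} u \<partial>lborel)"
  proof (rule nn_integral_cong_AE)
    have "AE u in lborel. u \<noteq> (0 :: real) \<and> u \<noteq> 1"
      using AE_lborel_singleton[of 0] AE_lborel_singleton[of 1] by eventually_elim simp
    then show "AE u in lborel.
        (\<integral>\<^sup>+l. ennreal l * ennreal (?h (l * u, l * (1 - u))) * indicator {0..1} l \<partial>lborel)
          * indicator {0..1} u
        = ennreal (kernel_moment k ?n (?w u) / 2 ^ Suc k) * indicator {0<..<1} u"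
    proof eventually_elim
      case (elim u)
      show ?case
      proof (cases "u \<in> {0<..<1}")
        case True
        then have "indicator {0..1} u = (1 :: ennreal)" "indicator {0<..<1} u = (1 :: ennreal)"
          by (auto simp: indicator_def)
        then show ?thesis by (simp only: inner[OF True])
      next
        case False
        with elim show ?thesis by (auto simp: indicator_def)
      qed
    qed
  qed
  also have "\<dots> = ennreal C"
    using nonneg outer by (rule nn_integral_has_integral_lebesgue')
  finally show "(\<integral>\<^sup>+z. ennreal (?h z) * indicator unit_triangle z \<partial>lborel) = ennreal C" .
qed

definition invariant_form :: "nat \<Rightarrow> nat \<Rightarrow> nat \<Rightarrow> real \<times> real \<Rightarrow> real" where
  "invariant_form t i k = (\<lambda>(x, y). invariant_monomial i k x y / (1 - x\<^sup>2 - y\<^sup>2) ^ Suc t)"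

lemma invariant_form_measurable [measurable]: "invariant_form t i k \<in> borel_measurable borel"
  unfolding invariant_form_def invariant_monomial_def borel_prod[symmetric]
  by (cases "odd k") simp_all

lemma unit_triangle_bounds:
  assumes "(x, y) \<in> unit_triangle"
  shows "0 \<le> x" "0 \<le> y" "0 \<le> 1 - x\<^sup>2 - y\<^sup>2" "\<bar>x\<^sup>2 - y\<^sup>2\<bar> \<le> 1"
proof -
  show xy: "0 \<le> x" "0 \<le> y" using assms by (auto simp: unit_triangle_def)
  have "x \<le> 1" "y \<le> 1" "x + y \<le> 1" using assms by (auto simp: unit_triangle_def)
  with xy have "x * x \<le> x * 1" "y * y \<le> y * 1" "0 \<le> x * x" "0 \<le> y * y"
    using mult_left_mono[of x 1 x] mult_left_mono[of y 1 y] by auto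
  with \<open>x + y \<le> 1\<close> \<open>x \<le> 1\<close> \<open>y \<le> 1\<close>
  show "0 \<le> 1 - x\<^sup>2 - y\<^sup>2" "\<bar>x\<^sup>2 - y\<^sup>2\<bar> \<le> 1"
    unfolding power2_eq_square abs_le_iff by linarith+
qed

lemma invariant_form_integrable:
  assumes "t \<le> i + k"
  shows "set_integrable lborel unit_triangle (invariant_form t i k)"
  unfolding set_integrable_def
proof (rule integrableI_bounded)
  show "(\<lambda>z. indicat_real unit_triangle z *\<^sub>R invariant_form t i k z) \<in> borel_measurable lborel"
    by simp
  let ?h = "\<lambda>z :: real \<times> real. case z of (x, y) \<Rightarrow>
        (1 - x\<^sup>2 - y\<^sup>2) ^ i * (x * y) ^ k / (1 - x\<^sup>2 - y\<^sup>2) ^ Suc t"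
  have "norm (indicat_real unit_triangle z *\<^sub>R invariant_form t i k z) \<le> ?h z"
    if "z \<in> unit_triangle" for z
  proof (cases z)
    case (Pair x y)
    with that have bounds: "0 \<le> x" "0 \<le> y" "0 \<le> 1 - x\<^sup>2 - y\<^sup>2" "\<bar>x\<^sup>2 - y\<^sup>2\<bar> \<le> 1"
      using unit_triangle_bounds[of x y] by auto
    then have h: "0 \<le> ?h (x, y)"
      by simp
    have "invariant_form t i k (x, y) = ?h (x, y) * (if odd k then x\<^sup>2 - y\<^sup>2 else 1)"
      by (simp add: invariant_form_def invariant_monomial_def)
    then have "\<bar>invariant_form t i k (x, y)\<bar> = ?h (x, y) * \<bar>if odd k then x\<^sup>2 - y\<^sup>2 else 1\<bar>"
      using h by (simp only: abs_mult abs_of_nonneg)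
    also have "\<dots> \<le> ?h (x, y) * 1"
      using h bounds by (intro mult_left_mono) auto
    finally show ?thesis
      using that Pair by simp
  qed
  then have "(\<integral>\<^sup>+z. ennreal (norm (indicat_real unit_triangle z *\<^sub>R invariant_form t i k z)) \<partial>lborel)
      \<le> (\<integral>\<^sup>+z. ennreal (?h z) * indicator unit_triangle z \<partial>lborel)"
    by (intro nn_integral_mono) (auto simp: indicator_def intro!: ennreal_leI)
  also have "\<dots> < \<infinity>"
    unfolding monomial_nn_integral(2)[OF assms] by simp
  finally show "(\<integral>\<^sup>+z. ennreal (norm (indicat_real unit_triangle z *\<^sub>R invariant_form t i k z)) \<partial>lborel) < \<infinity>" .
qed

text \<open>
  For even \<open>k\<close> the form is the monomial computed above. For odd \<open>k\<close> the factor \<open>x\<^sup>2 - y\<^sup>2\<close> makes it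
  antisymmetric under exchanging \<open>x\<close> and \<open>y\<close>, which preserves the triangle.
\<close>

lemma invariant_form_integral:
  assumes "t \<le> i + k"
  shows "set_lebesgue_integral lborel unit_triangle (invariant_form t i k) \<in> catalan_span"
proof (cases "even k")
  case True
  let ?h = "\<lambda>z :: real \<times> real. case z of (x, y) \<Rightarrow>
        (1 - x\<^sup>2 - y\<^sup>2) ^ i * (x * y) ^ k / (1 - x\<^sup>2 - y\<^sup>2) ^ Suc t"
  have form: "invariant_form t i k = ?h"
    using True by (simp add: invariant_form_def invariant_monomial_def fun_eq_iff)
  let ?C = "integral {0..1} (\<lambda>u. kernel_moment k (i + k - t) (2 * u * (1 - u))) / 2 ^ Suc k"
  have "set_lebesgue_integral lborel unit_triangle (invariant_form t i k)
      = enn2real (\<integral>\<^sup>+z. ennreal (indicat_real unit_triangle z *\<^sub>R invariant_form t i k z) \<partial>lborel)"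
    unfolding set_lebesgue_integral_def
  proof (rule integral_eq_nn_integral)
    show "AE z in lborel. 0 \<le> indicat_real unit_triangle z *\<^sub>R invariant_form t i k z"
      unfolding form using unit_triangle_bounds by (intro AE_I2) (auto simp: indicator_def)
  qed simp
  also have "(\<integral>\<^sup>+z. ennreal (indicat_real unit_triangle z *\<^sub>R invariant_form t i k z) \<partial>lborel)
      = (\<integral>\<^sup>+z. ennreal (?h z) * indicator unit_triangle z \<partial>lborel)"
    unfolding form by (intro nn_integral_cong) (auto simp: indicator_def)
  also have "enn2real \<dots> = of_rat (1 / 2 ^ Suc k)
      * integral {0..1} (\<lambda>u. kernel_moment k (i + k - t) (2 * u * (1 - u)))"
    unfolding monomial_nn_integral(2)[OF assms] enn2real_ennreal[OF monomial_nn_integral(1)[OF assms]]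
    by (simp add: of_rat_divide of_rat_mult of_rat_power)
  also have "\<dots> \<in> catalan_span"
    using True by (intro catalan_span_scale kernel_moment_integral)
  finally show ?thesis .
next
  case False
  let ?g = "\<lambda>z. indicat_real unit_triangle z *\<^sub>R invariant_form t i k z"
  have swap: "?g (y, x) = - ?g (x, y)" for x y
  proof -
    have "(y, x) \<in> unit_triangle \<longleftrightarrow> (x, y) \<in> unit_triangle"
      by (auto simp: unit_triangle_def)
    moreover have "invariant_form t i k (y, x) = - invariant_form t i k (x, y)"
    proof -
      have D: "1 - y\<^sup>2 - x\<^sup>2 = 1 - x\<^sup>2 - y\<^sup>2" by simp
      have S: "y\<^sup>2 - x\<^sup>2 = - (x\<^sup>2 - y\<^sup>2)" by simp
      show ?thesis
        using False unfolding invariant_form_def invariant_monomial_def prod.case D mult.commute[of y x]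
        by (simp only: if_True S not_False_eq_True mult_minus_right minus_divide_left)
    qed
    ultimately show ?thesis by (simp add: indicator_def)
  qed
  have "integral\<^sup>L lborel ?g = (\<integral>(x, y). ?g (y, x) \<partial>lborel)"
    using lborel_pair.integral_product_swap[of ?g] by (simp add: lborel_prod)
  also have "(\<lambda>(x, y). ?g (y, x)) = (\<lambda>z. - ?g z)"
  proof
    fix z :: "real \<times> real"
    show "(case z of (x, y) \<Rightarrow> ?g (y, x)) = - ?g z"
      by (cases z) (simp only: prod.case, rule swap)
  qed
  also have "integral\<^sup>L lborel (\<lambda>z. - ?g z) = - integral\<^sup>L lborel ?g"
    by simp
  finally have "set_lebesgue_integral lborel unit_triangle (invariant_form t i k) = 0"
    by (simp add: set_lebesgue_integral_def)
  then show ?thesis using catalan_span_rat[of 0] by simp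
qed

theorem theorem7p2p4:
  fixes t :: nat and F :: "rat poly poly"
  assumes "sigma_aut F = F"
    and "integrable_form F t"
  shows "set_integrable lborel unit_triangle (omega F t) \<and>
    (\<exists>a b :: rat. set_lebesgue_integral lborel unit_triangle (omega F t)
       = of_rat a + of_rat b * catalan_const)"
proof -
  obtain N c where c: "\<And>x y. real_eval F x y
      = (\<Sum>e\<in>{t..N}. \<Sum>k\<le>e. of_rat (c e k) * invariant_monomial (e - k) k x y)"
    by (rule sigma_invariant_expansion[OF assms], rule that)
  let ?g = "\<lambda>e k z. indicat_real unit_triangle z *\<^sub>R invariant_form t (e - k) k z"
  have "omega F t z = (\<Sum>e\<in>{t..N}. \<Sum>k\<le>e. of_rat (c e k) * invariant_form t (e - k) k z)" for z
    by (cases z) (simp add: omega_def c invariant_form_def sum_divide_distrib)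
  then have expansion: "indicat_real unit_triangle z *\<^sub>R omega F t z
      = (\<Sum>e\<in>{t..N}. \<Sum>k\<le>e. of_rat (c e k) * ?g e k z)" for z
    by (simp add: sum_distrib_left mult.left_commute)
  have integrable: "integrable lborel (?g e k)" if "e \<in> {t..N}" "k \<le> e" for e k
    using invariant_form_integrable[of t "e - k" k] that by (simp add: set_integrable_def)
  have "set_integrable lborel unit_triangle (omega F t)"
    unfolding set_integrable_def expansion
    by (intro Bochner_Integration.integrable_sum integrable_mult_right integrable) auto
  moreover have "set_lebesgue_integral lborel unit_triangle (omega F t)
      = (\<Sum>e\<in>{t..N}. \<Sum>k\<le>e. of_rat (c e k)
          * set_lebesgue_integral lborel unit_triangle (invariant_form t (e - k) k))"
  proof -
    have "set_lebesgue_integral lborel unit_triangle (omega F t)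
        = (\<Sum>e\<in>{t..N}. \<integral>z. (\<Sum>k\<le>e. of_rat (c e k) * ?g e k z) \<partial>lborel)"
      unfolding set_lebesgue_integral_def expansion
      by (intro Bochner_Integration.integral_sum Bochner_Integration.integrable_sum
          integrable_mult_right integrable) auto
    also have "\<dots> = (\<Sum>e\<in>{t..N}. \<Sum>k\<le>e. \<integral>z. of_rat (c e k) * ?g e k z \<partial>lborel)"
      by (intro sum.cong refl Bochner_Integration.integral_sum integrable_mult_right integrable) auto
    finally show ?thesis
      by (simp only: set_lebesgue_integral_def integral_mult_right_zero)
  qed
  moreover have "\<dots> \<in> catalan_span"
    by (intro catalan_span_sum catalan_span_scale invariant_form_integral) auto
  ultimately show ?thesis
    by (auto simp: catalan_span_def)
qed

end
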